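(* Let $G$ be a Feynman graph without bridges, i.e. $G$ cannot be disconnected by removing a single internal edge. A parameter vector $z=(m_e,k_{ij})$ lies in the interior of the copositive cone $\mathcal{C}_G$ if and only if $m_1,\dots,m_n>0$ and there exists $r\in\mathbb{N}$ such that the polynomial $(x_1+\cdots+x_n)^r\,\mathcal{F}_z(x)$ has only positive coefficients.
   Context: A Feynman graph is a finite connected graph $G$ (parallel edges and loops allowed) with vertex set $V$ and edge set $E$. An edge incident to a vertex of valency $1$ is external; all other edges are internal. $G$ has $N$ external edges, labelled by $[N]=\{1,\dots,N\}$, and $n$ internal edges, labelled by $[n]=\{1,\dots,n\}$; the variables $x_1,\dots,x_n$ correspond to the internal edges. The kinematic parameters $z$ consist of arbitrary real numbers $m_1,\dots,m_n$ and an arbitrary real symmetric $N\times N$ matrix $(k_{ij})$ with zero row sums (momentum conservation); thus $z$ ranges over a real vector space identified with $\mathbb{R}^{\binom N2+n}$ via the coordinates $m_e$ and $k_{ij}$, $i<j$. A spanning tree is a connected subgraph without cycles containing all vertices; $\mathcal{T}$ is the set of spanning trees. The first Symanzik polynomial is $\mathcal{U}(x)=\sum_{T\in\mathcal{T}}\prod_{e\notin T}x_e$. A spanning $2$-forest is a subgraph containing all vertices and all external edges, with no cycle, and with exactly two connected components $T_1,T_2$; $\mathcal{W}$ is the set of all spanning $2$-forests, and $I_{T_1},I_{T_2}\subset[N]$ are the index sets of external edges attached to $T_1$ and $T_2$. The second Symanzik polynomial is $$\mathcal{F}_z(x)=\sum_{\{T_1,T_2\}\in\mathcal{W}}\Big(\sum_{i\in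 I_{T_1}}\sum_{j\in I_{T_2}}k_{ij}\Big)\prod_{e\notin T_1\sqcup T_2}x_e+\Big(\sum_{e=1}^n m_ex_e\Big)\mathcal{U}(x).$$ The copositive cone is $\mathcal{C}_G=\{z\in\mathbb{R}^{\binom N2+n}:\mathcal{F}_z(u)\ge0\text{ for all }u\in\mathbb{R}^n_{\ge0}\}$, and its interior is taken in $\mathbb{R}^{\binom N2+n}$. A polynomial "has only positive coefficients" if each coefficient of a monomial actually occurring in it (i.e. each nonzero coefficient) is positive. *)

theory Defs
  imports "HOL-Analysis.Analysis" "HOL-Library.Poly_Mapping" "HOL-Library.Uprod"
begin

section \<open>Multigraphs\<close>

text \<open>
  Undirected graphs with parallel edges and loops: an edge is a name, and \<open>ends\<close> gives its
  unordered pair of end points (a loop at \<open>v\<close> has ends \<open>Upair v v\<close>).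
\<close>

record ('v, 'e) mgraph =
  verts :: "'v set"
  edges :: "'e set"
  ends :: "'e \<Rightarrow> 'v uprod"

definition finite_mgraph :: "('v, 'e) mgraph \<Rightarrow> bool" where
  "finite_mgraph G \<longleftrightarrow> finite (verts G) \<and> finite (edges G) \<and>
     (\<forall>e\<in>edges G. set_uprod (ends G e) \<subseteq> verts G)"

definition adjacency :: "('v, 'e) mgraph \<Rightarrow> ('v \<times> 'v) set" where
  "adjacency G = {(v, w). \<exists>e\<in>edges G. ends G e = Upair v w}"

definition connected_mgraph :: "('v, 'e) mgraph \<Rightarrow> bool" where
  "connected_mgraph G \<longleftrightarrow>
     verts G \<noteq> {} \<and> (\<forall>v\<in>verts G. \<forall>w\<in>verts G. (v, w) \<in> (adjacency G)\<^sup>*)"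

text \<open>A loop is a cycle of length 1, and two parallel edges form a cycle of length 2.\<close>

definition is_cycle :: "('v, 'e) mgraph \<Rightarrow> 'v list \<Rightarrow> 'e list \<Rightarrow> bool" where
  "is_cycle G vs es \<longleftrightarrow>
     es \<noteq> [] \<and> length vs = length es \<and> distinct vs \<and> distinct es \<and> set es \<subseteq> edges G \<and>
     (\<forall>i<length es. ends G (es ! i) = Upair (vs ! i) (vs ! (Suc i mod length es)))"

definition acyclic_mgraph :: "('v, 'e) mgraph \<Rightarrow> bool" where
  "acyclic_mgraph G \<longleftrightarrow> \<not> (\<exists>vs es. is_cycle G vs es)"

definition subgraph :: "('v, 'e) mgraph \<Rightarrow> ('v, 'e) mgraph \<Rightarrow> bool" where
  "subgraph H G \<longleftrightarrow> verts H \<subseteq> verts G \<and> edges H \<subseteq> edges G \<and> ends H = ends G \<and>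
     (\<forall>e\<in>edges H. set_uprod (ends H e) \<subseteq> verts H)"

definition delete_edge :: "('v, 'e) mgraph \<Rightarrow> 'e \<Rightarrow> ('v, 'e) mgraph" where
  "delete_edge G e = G\<lparr>edges := edges G - {e}\<rparr>"

definition component_of :: "('v, 'e) mgraph \<Rightarrow> 'v \<Rightarrow> ('v, 'e) mgraph" where
  "component_of H v =
     (let W = {w \<in> verts H. (v, w) \<in> (adjacency H)\<^sup>*}
      in \<lparr>verts = W, edges = {e \<in> edges H. set_uprod (ends H e) \<subseteq> W}, ends = ends H\<rparr>)"

definition components_mgraph :: "('v, 'e) mgraph \<Rightarrow> ('v, 'e) mgraph set" where
  "components_mgraph H = component_of H ` verts H"

text \<open>A loop contributes 2 to the valency of its vertex.\<close>

definition valency :: "('v, 'e) mgraph \<Rightarrow> 'v \<Rightarrow> nat" where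
  "valency G v = card {e \<in> edges G. v \<in> set_uprod (ends G e)}
               + card {e \<in> edges G. ends G e = Upair v v}"

definition external_edges :: "('v, 'e) mgraph \<Rightarrow> 'e set" where
  "external_edges G = {e \<in> edges G. \<exists>v \<in> set_uprod (ends G e). valency G v = 1}"

definition internal_edges :: "('v, 'e) mgraph \<Rightarrow> 'e set" where
  "internal_edges G = edges G - external_edges G"

definition spanning_trees :: "('v, 'e) mgraph \<Rightarrow> ('v, 'e) mgraph set" where
  "spanning_trees G =
     {T. subgraph T G \<and> verts T = verts G \<and> connected_mgraph T \<and> acyclic_mgraph T}"

definition spanning_two_forests :: "('v, 'e) mgraph \<Rightarrow> ('v, 'e) mgraph set" where
  "spanning_two_forests G =
     {H. subgraph H G \<and> verts H = verts G \<and> external_edges G \<subseteq> edges H \<and>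
         acyclic_mgraph H \<and> card (components_mgraph H) = 2}"


section \<open>Feynman graphs\<close>

record ('v, 'e) feynman =
  graph :: "('v, 'e) mgraph"
  num_ext :: nat
  num_int :: nat
  ext_edge :: "nat \<Rightarrow> 'e"
  int_edge :: "nat \<Rightarrow> 'e"

definition feynman_graph :: "('v, 'e) feynman \<Rightarrow> bool" where
  "feynman_graph G \<longleftrightarrow> finite_mgraph (graph G) \<and> connected_mgraph (graph G) \<and>
     bij_betw (ext_edge G) {1..num_ext G} (external_edges (graph G)) \<and>
     bij_betw (int_edge G) {1..num_int G} (internal_edges (graph G))"

definition bridgeless :: "('v, 'e) feynman \<Rightarrow> bool" where
  "bridgeless G \<longleftrightarrow>
     (\<forall>e\<in>internal_edges (graph G). connected_mgraph (delete_edge (graph G) e))"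


section \<open>Polynomials in the variables \<open>x\<^sub>i\<close>, \<open>i :: nat\<close>\<close>

text \<open>
  A monomial is its finitely supported exponent vector, a polynomial a finitely supported
  family of coefficients; the ring structure is that of \<^theory>\<open>HOL-Library.Poly_Mapping\<close>.
\<close>

type_synonym real_mpoly = "(nat \<Rightarrow>\<^sub>0 nat) \<Rightarrow>\<^sub>0 real"

definition Var :: "nat \<Rightarrow> real_mpoly" where
  "Var i = Poly_Mapping.single (Poly_Mapping.single i 1) 1"

definition Const :: "real \<Rightarrow> real_mpoly" where
  "Const c = Poly_Mapping.single 0 c"

definition eval_mpoly :: "real_mpoly \<Rightarrow> (nat \<Rightarrow> real) \<Rightarrow> real" where
  "eval_mpoly p u =
     (\<Sum>a\<in>Poly_Mapping.keys p. Poly_Mapping.lookup p a *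
        (\<Prod>i\<in>Poly_Mapping.keys a. u i ^ Poly_Mapping.lookup a i))"

definition only_positive_coeffs :: "real_mpoly \<Rightarrow> bool" where
  "only_positive_coeffs p \<longleftrightarrow> (\<forall>a\<in>Poly_Mapping.keys p. Poly_Mapping.lookup p a > 0)"


section \<open>Kinematic parameters and Symanzik polynomials\<close>

type_synonym kinematics = "(nat \<Rightarrow> real) \<times> (nat \<Rightarrow> nat \<Rightarrow> real)"

text \<open>
  Parameters \<open>z = (m, k)\<close>, extended by \<open>0\<close> outside the index sets. Reading off \<open>m e\<close> and
  \<open>k i j\<close> for \<open>i < j\<close> identifies this vector space with Euclidean space of dimension
  \<open>(N choose 2) + n\<close> (the diagonal of \<open>k\<close> is determined by the vanishing row sums). The
  ambient product topology induces the Euclidean topology on it.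
\<close>

definition kinematic_space :: "('v, 'e) feynman \<Rightarrow> kinematics set" where
  "kinematic_space G = {(m, k).
     (\<forall>e. e \<notin> {1..num_int G} \<longrightarrow> m e = 0) \<and>
     (\<forall>i j. i \<notin> {1..num_ext G} \<or> j \<notin> {1..num_ext G} \<longrightarrow> k i j = 0) \<and>
     (\<forall>i\<in>{1..num_ext G}. \<forall>j\<in>{1..num_ext G}. k i j = k j i) \<and>
     (\<forall>i\<in>{1..num_ext G}. (\<Sum>j=1..num_ext G. k i j) = 0)}"

definition ext_labels :: "('v, 'e) feynman \<Rightarrow> ('v, 'e) mgraph \<Rightarrow> nat set" where
  "ext_labels G T = {i \<in> {1..num_ext G}. ext_edge G i \<in> edges T}"

text \<open>
  The complement of \<open>H\<close> as a monomial. Spanning trees and spanning 2-forests contain all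
  external edges, so only the internal edges contribute.
\<close>

definition complement_monomial :: "('v, 'e) feynman \<Rightarrow> ('v, 'e) mgraph \<Rightarrow> real_mpoly" where
  "complement_monomial G H = (\<Prod>e\<in>{e \<in> {1..num_int G}. int_edge G e \<notin> edges H}. Var e)"

definition symanzik_U :: "('v, 'e) feynman \<Rightarrow> real_mpoly" where
  "symanzik_U G = (\<Sum>T\<in>spanning_trees (graph G). complement_monomial G T)"

text \<open>
  The two components of a 2-forest are unordered; an arbitrary order is chosen, and by the
  symmetry of \<open>k\<close> the result does not depend on it (see \<open>momentum_coeff_eq\<close>).
\<close>

definition momentum_coeff ::
  "('v, 'e) feynman \<Rightarrow> (nat \<Rightarrow> nat \<Rightarrow> real) \<Rightarrow> ('v, 'e) mgraph \<Rightarrow> real" where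
  "momentum_coeff G k H =
     (let (T1, T2) = (SOME (T1, T2). components_mgraph H = {T1, T2})
      in \<Sum>i\<in>ext_labels G T1. \<Sum>j\<in>ext_labels G T2. k i j)"

lemma momentum_coeff_eq:
  assumes z: "(m, k) \<in> kinematic_space G" and C: "components_mgraph H = {T1, T2}"
  shows "momentum_coeff G k H = (\<Sum>i\<in>ext_labels G T1. \<Sum>j\<in>ext_labels G T2. k i j)"
proof -
  let ?P = "\<lambda>(A, B). components_mgraph H = {A, B}"
  obtain A B where AB: "(SOME p. ?P p) = (A, B)"
    by (cases "SOME p. ?P p")
  have "?P (SOME p. ?P p)"
    by (rule someI[of ?P "(T1, T2)"]) (simp add: C)
  then have "{A, B} = {T1, T2}"
    unfolding AB using C by simp
  then have *: "(A = T1 \<and> B = T2) \<or> (A = T2 \<and> B = T1)"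
    by (auto simp: doubleton_eq_iff)
  have sym: "(\<Sum>i\<in>ext_labels G T2. \<Sum>j\<in>ext_labels G T1. k i j)
           = (\<Sum>i\<in>ext_labels G T1. \<Sum>j\<in>ext_labels G T2. k i j)"
    using z by (subst sum.swap) (auto simp: kinematic_space_def ext_labels_def intro!: sum.cong)
  have "momentum_coeff G k H = (\<Sum>i\<in>ext_labels G A. \<Sum>j\<in>ext_labels G B. k i j)"
    unfolding momentum_coeff_def AB by simp
  then show ?thesis
    using * sym by auto
qed

fun symanzik_F :: "('v, 'e) feynman \<Rightarrow> kinematics \<Rightarrow> real_mpoly" where
  "symanzik_F G (m, k) =
     (\<Sum>H\<in>spanning_two_forests (graph G).
        Const (momentum_coeff G k H) * complement_monomial G H)
   + (\<Sum>e=1..num_int G. Const (m e) * Var e) * symanzik_U G"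

definition copositive_cone :: "('v, 'e) feynman \<Rightarrow> kinematics set" where
  "copositive_cone G = {z \<in> kinematic_space G.
     \<forall>u. (\<forall>e\<in>{1..num_int G}. u e \<ge> 0) \<longrightarrow> eval_mpoly (symanzik_F G z) u \<ge> 0}"

end

theory Submission
  imports Defs
begin

text \<open>
  Write \<open>s = x\<^sub>1 + \<dots> + x\<^sub>n\<close>. Both sides of the equivalence say the same as strict copositivity
  relative to \<open>s\<cdot>U\<close>: there is \<open>\<delta> > 0\<close> with \<open>F(u) \<ge> \<delta>\<cdot>s(u)\<cdot>U(u)\<close> for all \<open>u \<ge> 0\<close>.

  \<^emph>\<open>Interior\<close> (\<open>interior_copositive_cone_iff\<close>). Lowering all masses by \<open>t\<close> replaces \<open>F\<close> by
  \<open>F - t\<cdot>s\<cdot>U\<close>, so an interior point is strictly copositive with \<open>\<delta> = t\<close> for a small \<open>t\<close>. Conversely,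
  every monomial of a 2-forest is \<open>x\<^sub>e\<close> times the monomial of a spanning tree, because joining the two
  components by an edge \<open>e\<close> gives a spanning tree. Hence a change of the parameters changes \<open>F\<close>
  by at most a small multiple of \<open>s\<cdot>U\<close>, which the margin \<open>\<delta>\<cdot>s\<cdot>U\<close> absorbs.

  \<^emph>\<open>From strict copositivity to positive coefficients\<close> (\<open>strictly_copositive_imp_Polya\<close>). As in
  Polya's theorem, the coefficient of \<open>x\<^sup>\<alpha>\<close> in \<open>s\<^sup>r\<cdot>F\<close> is \<open>r!/\<alpha>!\<close> times the sum of the coefficients
  \<open>F\<^sub>a\<close>, each multiplied by the falling powers \<open>\<alpha>\<^sub>i (\<alpha>\<^sub>i - 1) \<cdots> (\<alpha>\<^sub>i - a\<^sub>i + 1)\<close>. The monomials of 2-forests are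
  squarefree, so their falling powers are the ordinary ones, and those of \<open>x\<^sub>i\<close> times a tree monomial
  containing \<open>x\<^sub>i\<close> differ by one tree monomial. The sum is therefore at least
  \<open>F(\<alpha>) - M\<cdot>U(\<alpha>) \<ge> (\<delta>\<cdot>s(\<alpha>) - M)\<cdot>U(\<alpha>)\<close> with \<open>M = |m\<^sub>1| + \<dots> + |m\<^sub>n|\<close>, and \<open>s(\<alpha>) \<ge> r\<close>. Zeros of \<open>F\<close>
  on the boundary of the orthant do no harm, since the error is itself a multiple of \<open>U\<close>.

  \<^emph>\<open>From positive coefficients to strict copositivity\<close> (\<open>Polya_imp_strictly_copositive\<close>). The
  coefficient of \<open>x\<^sub>i\<^bsup>r+1\<^esup>\<close> times the monomial of a tree \<open>T\<close> avoiding \<open>i\<close> is positive: a monomial of \<open>F\<close>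
  contributing to it is supported on the complement of \<open>T\<close>, but of higher degree than the tree
  monomials, which all have the same degree. So it is not squarefree and does not come from a 2-forest:
  it is \<open>x\<^sub>i\<close> times the monomial of \<open>T\<close>, and its coefficient a positive multiple of \<open>m\<^sub>i\<close>. Given
  \<open>u \<ge> 0\<close>, let \<open>u\<^sub>i\<close> be maximal. Since \<open>i\<close> is not a bridge, any tree can be exchanged for
  one that avoids \<open>i\<close>, without decreasing its monomial at \<open>u\<close>. So these monomials dominate
  \<open>s\<^bsup>r+1\<^esup>\<cdot>U\<close>, and dividing \<open>s\<^sup>r\<cdot>F\<close> by \<open>s\<^sup>r\<close> gives the bound.

  The argument uses of the graph only what \<open>symanzik_system\<close> records: the complements of
  spanning trees have the same cardinality and admit an exchange, and the complement of a 2-forest is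
  that of a tree with one more edge. The exchange property is proved for edge sets
  in \<open>spanning_tree_exchange\<close>.
\<close>


section \<open>Evaluation of polynomials is a ring homomorphism\<close>

abbreviation eval_monomial :: "(nat \<Rightarrow> real) \<Rightarrow> (nat \<Rightarrow>\<^sub>0 nat) \<Rightarrow> real" where
  "eval_monomial u a \<equiv> (\<Prod>i\<in>Poly_Mapping.keys a. u i ^ Poly_Mapping.lookup a i)"

lemma eval_monomial_superset:
  assumes "finite K" "Poly_Mapping.keys a \<subseteq> K"
  shows "eval_monomial u a = (\<Prod>i\<in>K. u i ^ Poly_Mapping.lookup a i)"
  by (rule prod.mono_neutral_left) (use assms in \<open>auto simp: in_keys_iff\<close>)

lemma eval_monomial_add: "eval_monomial u (a + b) = eval_monomial u a * eval_monomial u b"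
proof -
  let ?K = "Poly_Mapping.keys a \<union> Poly_Mapping.keys b"
  have "Poly_Mapping.keys (a + b) \<subseteq> ?K"
    by (auto simp: in_keys_iff lookup_add)
  then have "eval_monomial u (a + b) = (\<Prod>i\<in>?K. u i ^ Poly_Mapping.lookup (a + b) i)"
    by (intro eval_monomial_superset) auto
  also have "\<dots> = (\<Prod>i\<in>?K. u i ^ Poly_Mapping.lookup a i) * (\<Prod>i\<in>?K. u i ^ Poly_Mapping.lookup b i)"
    by (simp add: lookup_add power_add prod.distrib)
  also have "\<dots> = eval_monomial u a * eval_monomial u b"
    by (subst (1 2) eval_monomial_superset[of ?K]) auto
  finally show ?thesis .
qed

lemma eval_mpoly_superset:
  assumes "finite A" "Poly_Mapping.keys p \<subseteq> A"
  shows "eval_mpoly p u = (\<Sum>a\<in>A. Poly_Mapping.lookup p a * eval_monomial u a)"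
  unfolding eval_mpoly_def
  by (rule sum.mono_neutral_left) (use assms in \<open>auto simp: in_keys_iff\<close>)

lemma eval_mpoly_add: "eval_mpoly (p + q) u = eval_mpoly p u + eval_mpoly q u"
proof -
  let ?A = "Poly_Mapping.keys p \<union> Poly_Mapping.keys q"
  have "Poly_Mapping.keys (p + q) \<subseteq> ?A"
    by (auto simp: in_keys_iff lookup_add)
  then show ?thesis
    by (subst (1 2 3) eval_mpoly_superset[of ?A]) (auto simp: lookup_add algebra_simps sum.distrib)
qed

lemma eval_mpoly_0: "eval_mpoly 0 u = 0"
  by (simp add: eval_mpoly_def)

lemma eval_mpoly_sum: "eval_mpoly (\<Sum>x\<in>X. f x) u = (\<Sum>x\<in>X. eval_mpoly (f x) u)"
  by (induction X rule: infinite_finite_induct) (auto simp: eval_mpoly_0 eval_mpoly_add)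

lemma eval_mpoly_single: "eval_mpoly (Poly_Mapping.single a c) u = c * eval_monomial u a"
  by (subst eval_mpoly_superset[of "{a}"]) auto

lemma mpoly_as_sum:
  fixes p :: real_mpoly
  shows "p = (\<Sum>a\<in>Poly_Mapping.keys p. Poly_Mapping.single a (Poly_Mapping.lookup p a))"
  by (rule poly_mapping_eqI)
     (auto simp: lookup_sum lookup_single when_def sum.delta' in_keys_iff)

lemma eval_mpoly_mult: "eval_mpoly (p * q) u = eval_mpoly p u * eval_mpoly q u"
proof -
  let ?s = "\<lambda>(p::real_mpoly) a. Poly_Mapping.single a (Poly_Mapping.lookup p a)"
  have "p * q = (\<Sum>a\<in>Poly_Mapping.keys p. ?s p a) * (\<Sum>b\<in>Poly_Mapping.keys q. ?s q b)"
    by (subst mpoly_as_sum[of p], subst mpoly_as_sum[of q]) (rule refl)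
  also have "\<dots> = (\<Sum>a\<in>Poly_Mapping.keys p. \<Sum>b\<in>Poly_Mapping.keys q.
      Poly_Mapping.single (a + b) (Poly_Mapping.lookup p a * Poly_Mapping.lookup q b))"
    by (simp add: sum_product mult_single)
  finally have "eval_mpoly (p * q) u = (\<Sum>a\<in>Poly_Mapping.keys p. \<Sum>b\<in>Poly_Mapping.keys q.
      (Poly_Mapping.lookup p a * Poly_Mapping.lookup q b) * eval_monomial u (a + b))"
    by (simp only: eval_mpoly_sum eval_mpoly_single)
  also have "\<dots> = eval_mpoly p u * eval_mpoly q u"
    unfolding eval_monomial_add eval_mpoly_def sum_product by (simp add: mult_ac)
  finally show ?thesis .
qed

lemma eval_mpoly_Const: "eval_mpoly (Const c) u = c"
  by (simp add: Const_def eval_mpoly_single)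

lemma eval_mpoly_Var: "eval_mpoly (Var i) u = u i"
  by (simp add: Var_def eval_mpoly_single)

lemma eval_mpoly_1: "eval_mpoly 1 u = 1"
  by (simp add: eval_mpoly_Const[of 1, unfolded Const_def single_one])

lemma eval_mpoly_power: "eval_mpoly (p ^ r) u = eval_mpoly p u ^ r"
  by (induction r) (auto simp: eval_mpoly_1 eval_mpoly_mult)

lemma eval_mpoly_prod: "eval_mpoly (\<Prod>x\<in>X. f x) u = (\<Prod>x\<in>X. eval_mpoly (f x) u)"
  by (induction X rule: infinite_finite_induct) (auto simp: eval_mpoly_1 eval_mpoly_mult)

lemmas eval_mpoly_simps = eval_mpoly_add eval_mpoly_sum eval_mpoly_mult eval_mpoly_Const
  eval_mpoly_Var eval_mpoly_power eval_mpoly_prod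


section \<open>Coefficients of a product with a power of the sum of the variables\<close>

definition squarefree_exponent :: "nat set \<Rightarrow> (nat \<Rightarrow>\<^sub>0 nat)" where
  "squarefree_exponent A = (\<Sum>i\<in>A. Poly_Mapping.single i 1)"

lemma lookup_squarefree_exponent:
  "finite A \<Longrightarrow> Poly_Mapping.lookup (squarefree_exponent A) i = (if i \<in> A then 1 else 0)"
  by (auto simp: squarefree_exponent_def lookup_sum lookup_single when_def)

lemma prod_Var: "finite A \<Longrightarrow> (\<Prod>i\<in>A. Var i) = Poly_Mapping.single (squarefree_exponent A) 1"
  by (induction A rule: finite_induct)
     (auto simp: squarefree_exponent_def Var_def mult_single)

lemma Var_times_prod_Var:
  "finite A \<Longrightarrow> Var i * (\<Prod>j\<in>A. Var j) =
    Poly_Mapping.single (Poly_Mapping.single i 1 + squarefree_exponent A) 1"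
  by (simp add: prod_Var) (simp add: Var_def mult_single)

definition total_degree_on :: "nat set \<Rightarrow> (nat \<Rightarrow>\<^sub>0 nat) \<Rightarrow> nat" where
  "total_degree_on I a = (\<Sum>i\<in>I. Poly_Mapping.lookup a i)"

text \<open>
  The product of the falling powers \<open>\<alpha>\<^sub>i (\<alpha>\<^sub>i - 1) \<cdots> (\<alpha>\<^sub>i - a\<^sub>i + 1)\<close>. Writing them with binomial
  coefficients makes them vanish for \<open>a\<^sub>i > \<alpha>\<^sub>i\<close> by itself.
\<close>

definition falling_power :: "nat set \<Rightarrow> (nat \<Rightarrow>\<^sub>0 nat) \<Rightarrow> (nat \<Rightarrow>\<^sub>0 nat) \<Rightarrow> real" where
  "falling_power I \<alpha> a = (\<Prod>i\<in>I. fact (Poly_Mapping.lookup a i) *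
     real (Poly_Mapping.lookup \<alpha> i choose Poly_Mapping.lookup a i))"

definition factorial_exponent :: "nat set \<Rightarrow> (nat \<Rightarrow>\<^sub>0 nat) \<Rightarrow> real" where
  "factorial_exponent I \<alpha> = (\<Prod>i\<in>I. fact (Poly_Mapping.lookup \<alpha> i))"

lemma lookup_single_times:
  fixes q :: real_mpoly
  shows "Poly_Mapping.lookup (Poly_Mapping.single b c * q) (b + \<beta>) = c * Poly_Mapping.lookup q \<beta>"
proof -
  have "Poly_Mapping.single b c * q =
     (\<Sum>a\<in>Poly_Mapping.keys q. Poly_Mapping.single (b + a) (c * Poly_Mapping.lookup q a))"
    by (subst mpoly_as_sum[of q]) (simp add: sum_distrib_left mult_single)
  then show ?thesis
    by (auto simp: lookup_sum lookup_single when_def sum.delta' in_keys_iff)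
qed

lemma lookup_Var_times:
  fixes q :: real_mpoly
  shows "Poly_Mapping.lookup (Var i * q) \<alpha> =
    (if Poly_Mapping.lookup \<alpha> i = 0 then 0
     else Poly_Mapping.lookup q (\<alpha> - Poly_Mapping.single i 1))"
proof (cases "Poly_Mapping.lookup \<alpha> i = 0")
  case True
  have "Poly_Mapping.keys (Var i * q) \<subseteq> {Poly_Mapping.single i 1 + b | b. b \<in> Poly_Mapping.keys q}"
    using keys_mult[of "Var i" q] by (auto simp: Var_def)
  then have "\<alpha> \<notin> Poly_Mapping.keys (Var i * q)"
    using True by (auto simp: lookup_add)
  then show ?thesis
    using True by (simp add: in_keys_iff)
next
  case False
  then have "\<alpha> = Poly_Mapping.single i 1 + (\<alpha> - Poly_Mapping.single i 1)"
    by (intro poly_mapping_eqI) (auto simp: lookup_add lookup_minus lookup_single when_def)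
  then show ?thesis
    using False lookup_single_times[of "Poly_Mapping.single i 1" 1 q "\<alpha> - Poly_Mapping.single i 1"]
    by (simp add: Var_def)
qed

text \<open>
  Both recursions below compare products over \<open>I\<close> whose factors differ at a single index.
\<close>

lemma prod_change_one_factor:
  fixes f g :: "nat \<Rightarrow> real"
  assumes "finite I" "i \<in> I" "\<And>j. j \<in> I \<Longrightarrow> j \<noteq> i \<Longrightarrow> g j = f j" "x * g i = y * f i"
  shows "x * (\<Prod>j\<in>I. g j) = y * (\<Prod>j\<in>I. f j)"
proof -
  have "x * (\<Prod>j\<in>I. g j) = (x * g i) * (\<Prod>j\<in>I-{i}. g j)"
    using assms(1,2) by (simp add: prod.remove)
  also have "(\<Prod>j\<in>I-{i}. g j) = (\<Prod>j\<in>I-{i}. f j)"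
    using assms(3) by (intro prod.cong) auto
  also have "(x * g i) * (\<Prod>j\<in>I-{i}. f j) = y * (\<Prod>j\<in>I. f j)"
    using assms(1,2,4) by (simp add: prod.remove mult_ac)
  finally show ?thesis .
qed

text \<open>
  At the index \<open>i\<close> this is the absorption identity for binomial coefficients: with \<open>n = \<alpha>\<^sub>i\<close> and
  \<open>k = a\<^sub>i\<close>, both sides are \<open>n (n - 1) \<cdots> (n - k)\<close>.
\<close>

lemma falling_power_decrease:
  assumes "finite I" "i \<in> I" "Poly_Mapping.lookup \<alpha> i > 0"
  shows "Poly_Mapping.lookup \<alpha> i * falling_power I (\<alpha> - Poly_Mapping.single i 1) a =
    (real (Poly_Mapping.lookup \<alpha> i) - real (Poly_Mapping.lookup a i)) * falling_power I \<alpha> a"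
  unfolding falling_power_def
proof (rule prod_change_one_factor[OF assms(1,2)])
  let ?n = "Poly_Mapping.lookup \<alpha> i" and ?k = "Poly_Mapping.lookup a i"
  have "real ?n * real ((?n - 1) choose ?k) = (real ?n - real ?k) * real (?n choose ?k)"
  proof (cases "?k \<le> ?n")
    case True
    have "real (?n * ((?n - 1) choose ?k)) = real ((?n - ?k) * (?n choose ?k))"
      by (simp only: binomial_absorb_comp)
    then show ?thesis
      using True by (simp add: of_nat_diff)
  qed (simp add: binomial_eq_0)
  then show "real ?n * (fact ?k * real (Poly_Mapping.lookup (\<alpha> - Poly_Mapping.single i 1) i choose ?k)) =
      (real ?n - real ?k) * (fact ?k * real (?n choose ?k))"
    by (simp add: lookup_minus)
qed (auto simp: lookup_minus lookup_single when_def)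

lemma factorial_exponent_decrease:
  assumes "finite I" "i \<in> I" "Poly_Mapping.lookup \<alpha> i > 0"
  shows "factorial_exponent I \<alpha> =
    Poly_Mapping.lookup \<alpha> i * factorial_exponent I (\<alpha> - Poly_Mapping.single i 1)"
proof -
  have "real (Poly_Mapping.lookup \<alpha> i) * factorial_exponent I (\<alpha> - Poly_Mapping.single i 1) =
    1 * factorial_exponent I \<alpha>"
    unfolding factorial_exponent_def
    by (rule prod_change_one_factor[OF assms(1,2)])
       (use assms(3) in \<open>auto simp: lookup_minus lookup_single when_def fact_reduce[of "Poly_Mapping.lookup \<alpha> i"]\<close>)
  then show ?thesis by simp
qed

lemma falling_power_eq_0:
  assumes "finite I" "i \<in> I" "Poly_Mapping.lookup \<alpha> i < Poly_Mapping.lookup a i"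
  shows "falling_power I \<alpha> a = 0"
  unfolding falling_power_def using assms by (auto intro!: prod_zero)

text \<open>
  The multinomial theorem in the form used by Polya: after multiplication by \<open>\<alpha>!\<close> the coefficients
  depend on \<open>\<alpha>\<close> through a polynomial. In the induction on \<open>r\<close>, multiplication by \<open>x\<^sub>i\<close> shifts \<open>\<alpha>\<close> at \<open>i\<close>;
  summing \<open>falling_power_decrease\<close> over \<open>i\<close> produces the factor \<open>|\<alpha>| - |a| = r + 1\<close>.
\<close>

lemma lookup_power_sum_Var_times_single:
  assumes I: "finite I" and a: "Poly_Mapping.keys a \<subseteq> I"
  shows "factorial_exponent I \<alpha> *
      Poly_Mapping.lookup ((\<Sum>i\<in>I. Var i) ^ r * Poly_Mapping.single a 1) \<alpha> =
    (if Poly_Mapping.keys \<alpha> \<subseteq> I \<and> total_degree_on I \<alpha> = r + total_degree_on I a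
     then fact r * falling_power I \<alpha> a else 0)"
proof (induction r arbitrary: \<alpha>)
  case 0
  show ?case
  proof (cases "\<alpha> = a")
    case True
    then show ?thesis
      using a by (simp add: falling_power_def factorial_exponent_def)
  next
    case False
    \<comment> \<open>Two different exponents of equal degree: some entry of \<open>\<alpha>\<close> is below that of \<open>a\<close>.\<close>
    have "falling_power I \<alpha> a = 0"
      if "Poly_Mapping.keys \<alpha> \<subseteq> I" "total_degree_on I \<alpha> = total_degree_on I a"
    proof (rule ccontr)
      assume nz: "falling_power I \<alpha> a \<noteq> 0"
      then have le: "\<forall>i\<in>I. Poly_Mapping.lookup a i \<le> Poly_Mapping.lookup \<alpha> i"
        using falling_power_eq_0[OF I] by (meson not_le)
      have "\<forall>i\<in>I. Poly_Mapping.lookup a i = Poly_Mapping.lookup \<alpha> i"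
        using sum_mono_inv[of "Poly_Mapping.lookup a" I "Poly_Mapping.lookup \<alpha>"] that(2) le I
        unfolding total_degree_on_def by auto
      moreover have "\<forall>i. i \<notin> I \<longrightarrow> Poly_Mapping.lookup a i = 0 \<and> Poly_Mapping.lookup \<alpha> i = 0"
        using that(1) a by (auto simp: in_keys_iff subset_eq)
      ultimately have "\<alpha> = a"
        by (intro poly_mapping_eqI) metis
      then show False using False by simp
    qed
    then show ?thesis
      using False by (simp add: lookup_single when_def)
  qed
next
  case (Suc r)
  let ?P = "\<lambda>r. (\<Sum>i\<in>I. Var i) ^ r * Poly_Mapping.single a (1::real)"
  let ?l = "\<lambda>i. Poly_Mapping.lookup \<alpha> i"
  let ?dec = "\<lambda>i. \<alpha> - Poly_Mapping.single i 1"
  let ?C = "Poly_Mapping.keys \<alpha> \<subseteq> I \<and> total_degree_on I \<alpha> = Suc r + total_degree_on I a"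
  have step: "factorial_exponent I \<alpha> * Poly_Mapping.lookup (Var i * ?P r) \<alpha> =
      (if ?C then fact r * ((real (?l i) - real (Poly_Mapping.lookup a i)) * falling_power I \<alpha> a) else 0)"
    if i: "i \<in> I" for i
  proof (cases "?l i = 0")
    case True
    show ?thesis
    proof (cases "Poly_Mapping.lookup a i = 0")
      case False
      then show ?thesis
        using True falling_power_eq_0[OF I i, of \<alpha> a] by (simp add: lookup_Var_times)
    qed (use True in \<open>simp add: lookup_Var_times\<close>)
  next
    case False
    have keys: "Poly_Mapping.keys (?dec i) \<subseteq> I \<longleftrightarrow> Poly_Mapping.keys \<alpha> \<subseteq> I"
    proof -
      have "j \<in> Poly_Mapping.keys (?dec i) \<longleftrightarrow> j \<in> Poly_Mapping.keys \<alpha>" if "j \<noteq> i" for j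
        using that by (simp add: in_keys_iff lookup_minus lookup_single when_def)
      then show ?thesis
        using i by (metis subset_eq)
    qed
    have "total_degree_on I \<alpha> = Suc (total_degree_on I (?dec i))"
      unfolding total_degree_on_def using False i I
      by (subst (1 2) sum.remove[of I i])
         (auto simp: lookup_minus lookup_single when_def intro!: sum.cong)
    then have C: "Poly_Mapping.keys (?dec i) \<subseteq> I \<and> total_degree_on I (?dec i) = r + total_degree_on I a \<longleftrightarrow> ?C"
      using keys by auto
    have "factorial_exponent I \<alpha> * Poly_Mapping.lookup (Var i * ?P r) \<alpha> =
        ?l i * (factorial_exponent I (?dec i) * Poly_Mapping.lookup (?P r) (?dec i))"
      using False factorial_exponent_decrease[OF I i, of \<alpha>] by (simp add: lookup_Var_times)
    also have "\<dots> = (if ?C then fact r * (?l i * falling_power I (?dec i) a) else 0)"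
      unfolding Suc.IH C by simp
    also have "?l i * falling_power I (?dec i) a =
        (real (?l i) - real (Poly_Mapping.lookup a i)) * falling_power I \<alpha> a"
      using falling_power_decrease[OF I i, of \<alpha> a] False by simp
    finally show ?thesis .
  qed
  have gen: "(\<Sum>i\<in>I. if c then x * ((f i - g i) * y) else 0) =
      (if c then x * ((sum f I - sum g I) * y) else 0)" for c :: bool and x y :: real and f g
    by (simp flip: sum_distrib_left sum_distrib_right sum_subtractf)
  have "?P (Suc r) = (\<Sum>i\<in>I. Var i * ?P r)"
    by (simp add: sum_distrib_right mult.assoc)
  then have "factorial_exponent I \<alpha> * Poly_Mapping.lookup (?P (Suc r)) \<alpha> =
      (\<Sum>i\<in>I. factorial_exponent I \<alpha> * Poly_Mapping.lookup (Var i * ?P r) \<alpha>)"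
    by (simp add: lookup_sum sum_distrib_left)
  also have "\<dots> = (\<Sum>i\<in>I. if ?C then fact r *
      ((real (?l i) - real (Poly_Mapping.lookup a i)) * falling_power I \<alpha> a) else 0)"
    by (rule sum.cong) (use step in auto)
  also have "\<dots> = (if ?C then fact r * ((real (total_degree_on I \<alpha>) - real (total_degree_on I a)) *
      falling_power I \<alpha> a) else 0)"
    using gen[of ?C "fact r"] by (simp only: total_degree_on_def of_nat_sum)
  also have "\<dots> = (if ?C then fact (Suc r) * falling_power I \<alpha> a else 0)"
    by (auto simp: algebra_simps)
  finally show ?case .
qed

lemma falling_power_squarefree:
  assumes "finite I" "A \<subseteq> I"
  shows "falling_power I \<alpha> (squarefree_exponent A) = (\<Prod>i\<in>A. real (Poly_Mapping.lookup \<alpha> i))"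
proof -
  have A: "finite A" using assms finite_subset by blast
  have "falling_power I \<alpha> (squarefree_exponent A) =
      (\<Prod>i\<in>I. if i \<in> A then real (Poly_Mapping.lookup \<alpha> i) else 1)"
    unfolding falling_power_def by (rule prod.cong) (auto simp: lookup_squarefree_exponent[OF A])
  also have "\<dots> = (\<Prod>i\<in>A. real (Poly_Mapping.lookup \<alpha> i))"
    using assms by (simp add: prod.If_cases Int_absorb1)
  finally show ?thesis .
qed

text \<open>
  For exponents of this kind the falling power differs from the ordinary one only by the correction \<open>-1\<close>,
  present if \<open>x\<^sub>i\<close> occurs squared.
\<close>

lemma falling_power_single_plus_squarefree:
  assumes I: "finite I" "A \<subseteq> I" and i: "i \<in> I"
  shows "falling_power I \<alpha> (Poly_Mapping.single i 1 + squarefree_exponent A) =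
    (real (Poly_Mapping.lookup \<alpha> i) - (if i \<in> A then 1 else 0)) *
    (\<Prod>i\<in>A. real (Poly_Mapping.lookup \<alpha> i))"
proof -
  have A: "finite A" using assms finite_subset by blast
  let ?n = "Poly_Mapping.lookup \<alpha> i"
  have two: "2 * real (?n choose 2) = (real ?n - 1) * real ?n"
  proof -
    have "2 * (?n choose 2) = ?n * (?n - 1)"
      using times_binomial_minus1_eq[of 2 ?n] by simp
    then have "real (2 * (?n choose 2)) = real (?n * (?n - 1))"
      by presburger
    then show ?thesis
      by (cases ?n) (auto simp: algebra_simps)
  qed
  have "1 * falling_power I \<alpha> (Poly_Mapping.single i 1 + squarefree_exponent A) =
    (real ?n - (if i \<in> A then 1 else 0)) * falling_power I \<alpha> (squarefree_exponent A)"
    unfolding falling_power_def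
    by (rule prod_change_one_factor[OF I(1) i])
       (use two in \<open>auto simp: lookup_add lookup_squarefree_exponent[OF A] lookup_single when_def
          numeral_2_eq_2\<close>)
  then show ?thesis
    using falling_power_squarefree[OF I] by simp
qed

lemma total_degree_on_add: "total_degree_on I (a + b) = total_degree_on I a + total_degree_on I b"
  by (simp add: total_degree_on_def lookup_add sum.distrib)

lemma total_degree_on_squarefree:
  assumes "finite I" "A \<subseteq> I"
  shows "total_degree_on I (squarefree_exponent A) = card A"
proof -
  have A: "finite A" using assms finite_subset by blast
  have "(\<Sum>i\<in>I. if i \<in> A then 1 else 0) = card A"
    using assms by (simp add: sum.If_cases Int_absorb1)
  then show ?thesis
    by (simp add: total_degree_on_def lookup_squarefree_exponent[OF A])
qed

lemma total_degree_on_single: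
  assumes "finite I" "i \<in> I"
  shows "total_degree_on I (Poly_Mapping.single i n) = n"
  using assms by (simp add: total_degree_on_def lookup_single when_def)

lemma keys_squarefree_exponent: "finite A \<Longrightarrow> Poly_Mapping.keys (squarefree_exponent A) = A"
  by (auto simp: in_keys_iff lookup_squarefree_exponent split: if_splits)

lemma lookup_times_Const_times:
  "Poly_Mapping.lookup (p * (Const c * q)) \<alpha> = c * Poly_Mapping.lookup (p * q) \<alpha>"
  using lookup_single_times[of 0 c "p * q" \<alpha>] by (simp add: Const_def mult.left_commute)


section \<open>Symanzik polynomials of an exchange system\<close>

text \<open>
  \<open>B T\<close> is the set of edges missing in the spanning tree \<open>T\<close>, and \<open>S H\<close> the set of edges missing in
  the 2-forest \<open>H\<close>. The assumption \<open>exchange\<close> is where the absence of bridges enters: whatever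
  tree contains the edge \<open>i\<close>, some edge \<open>j\<close> outside it can take over.
\<close>

locale symanzik_system =
  fixes I :: "nat set" and Ts :: "'a set" and Hs :: "'b set"
    and B :: "'a \<Rightarrow> nat set" and S :: "'b \<Rightarrow> nat set" and d :: nat
  assumes finite_I: "finite I" and finite_Ts: "finite Ts" and finite_Hs: "finite Hs"
    and Ts_nonempty: "Ts \<noteq> {}"
    and B_subset: "T \<in> Ts \<Longrightarrow> B T \<subseteq> I"
    and card_B: "T \<in> Ts \<Longrightarrow> card (B T) = d"
    and S_insert: "H \<in> Hs \<Longrightarrow> \<exists>T\<in>Ts. \<exists>i\<in>I - B T. S H = insert i (B T)"
    and exchange: "T \<in> Ts \<Longrightarrow> i \<in> I - B T \<Longrightarrow> \<exists>j\<in>B T. \<exists>T'\<in>Ts. B T' = insert i (B T - {j})"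
begin

definition U_poly :: real_mpoly where
  "U_poly = (\<Sum>T\<in>Ts. \<Prod>e\<in>B T. Var e)"

definition F_poly :: "(nat \<Rightarrow> real) \<Rightarrow> ('b \<Rightarrow> real) \<Rightarrow> real_mpoly" where
  "F_poly m c = (\<Sum>H\<in>Hs. Const (c H) * (\<Prod>e\<in>S H. Var e)) + (\<Sum>e\<in>I. Const (m e) * Var e) * U_poly"

definition U_val :: "(nat \<Rightarrow> real) \<Rightarrow> real" where
  "U_val u = (\<Sum>T\<in>Ts. \<Prod>e\<in>B T. u e)"

definition F_val :: "(nat \<Rightarrow> real) \<Rightarrow> ('b \<Rightarrow> real) \<Rightarrow> (nat \<Rightarrow> real) \<Rightarrow> real" where
  "F_val m c u = (\<Sum>H\<in>Hs. c H * (\<Prod>e\<in>S H. u e)) + (\<Sum>e\<in>I. m e * u e) * U_val u"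

text \<open>
  The margin is a multiple of \<open>s\<cdot>U\<close>, with \<open>s\<close> the sum of the variables: a margin \<open>s\<^bsup>d+1\<^esup>\<close> of the same degree
  would in general be too much to ask, as \<open>F\<close> vanishes wherever \<open>U\<close> does on the orthant.
\<close>

definition strictly_copositive :: "(nat \<Rightarrow> real) \<Rightarrow> ('b \<Rightarrow> real) \<Rightarrow> bool" where
  "strictly_copositive m c \<longleftrightarrow>
    (\<exists>\<delta>>0. \<forall>u. (\<forall>e\<in>I. u e \<ge> 0) \<longrightarrow> \<delta> * (\<Sum>e\<in>I. u e) * U_val u \<le> F_val m c u)"

lemma eval_F_poly: "eval_mpoly (F_poly m c) u = F_val m c u"
  by (simp add: F_poly_def U_poly_def F_val_def U_val_def eval_mpoly_simps)

lemma finite_B: "T \<in> Ts \<Longrightarrow> finite (B T)"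
  using B_subset finite_I finite_subset by blast

lemma S_subset: "H \<in> Hs \<Longrightarrow> S H \<subseteq> I"
  using S_insert B_subset by fastforce

lemma finite_S: "H \<in> Hs \<Longrightarrow> finite (S H)"
  using S_subset finite_I finite_subset by blast

lemma card_S: "H \<in> Hs \<Longrightarrow> card (S H) = Suc d"
  using S_insert[of H] card_B finite_B by force

lemma B_antichain: "T \<in> Ts \<Longrightarrow> T' \<in> Ts \<Longrightarrow> B T \<subseteq> B T' \<Longrightarrow> B T = B T'"
  using card_subset_eq[OF finite_B] card_B by metis

lemma S_not_subset_B: "H \<in> Hs \<Longrightarrow> T \<in> Ts \<Longrightarrow> \<not> S H \<subseteq> B T"
  using card_mono[OF finite_B[of T], of "S H"] card_S card_B by auto

lemma U_val_nonneg: "(\<And>e. e \<in> I \<Longrightarrow> u e \<ge> 0) \<Longrightarrow> U_val u \<ge> 0"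
  unfolding U_val_def using B_subset by (intro sum_nonneg prod_nonneg) blast

text \<open>
  All monomials of \<open>F\<close> have degree \<open>d + 1\<close>, so they contribute to the same \<open>\<alpha>\<close> and the coefficient
  formula can be summed over them.
\<close>

lemma lookup_power_times_F_poly:
  "factorial_exponent I \<alpha> * Poly_Mapping.lookup ((\<Sum>i\<in>I. Var i) ^ r * F_poly m c) \<alpha> =
    (if Poly_Mapping.keys \<alpha> \<subseteq> I \<and> total_degree_on I \<alpha> = r + Suc d then
       fact r * ((\<Sum>H\<in>Hs. c H * (\<Prod>e\<in>S H. real (Poly_Mapping.lookup \<alpha> e))) +
         (\<Sum>T\<in>Ts. \<Sum>i\<in>I. m i * ((real (Poly_Mapping.lookup \<alpha> i) - (if i \<in> B T then 1 else 0)) *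
           (\<Prod>e\<in>B T. real (Poly_Mapping.lookup \<alpha> e)))))
     else 0)"
proof -
  let ?X = "(\<Sum>i\<in>I. Var i) ^ r"
  let ?aH = "\<lambda>H. squarefree_exponent (S H)"
  let ?aT = "\<lambda>T i. Poly_Mapping.single i 1 + squarefree_exponent (B T)"
  let ?f = "factorial_exponent I \<alpha>"
  define C where "C \<longleftrightarrow> Poly_Mapping.keys \<alpha> \<subseteq> I \<and> total_degree_on I \<alpha> = r + Suc d"
  have "F_poly m c = (\<Sum>H\<in>Hs. Const (c H) * Poly_Mapping.single (?aH H) 1) +
      (\<Sum>T\<in>Ts. \<Sum>i\<in>I. Const (m i) * (Var i * (\<Prod>e\<in>B T. Var e)))"
    unfolding F_poly_def U_poly_def
    by (simp add: prod_Var finite_S sum_distrib_left sum_distrib_right mult.assoc)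
  also have "(\<Sum>T\<in>Ts. \<Sum>i\<in>I. Const (m i) * (Var i * (\<Prod>e\<in>B T. Var e))) =
      (\<Sum>T\<in>Ts. \<Sum>i\<in>I. Const (m i) * Poly_Mapping.single (?aT T i) 1)"
    by (intro sum.cong refl) (simp add: Var_times_prod_Var finite_B)
  finally have eq: "?f * Poly_Mapping.lookup (?X * F_poly m c) \<alpha> =
      (\<Sum>H\<in>Hs. c H * (?f * Poly_Mapping.lookup (?X * Poly_Mapping.single (?aH H) 1) \<alpha>)) +
      (\<Sum>T\<in>Ts. \<Sum>i\<in>I. m i * (?f * Poly_Mapping.lookup (?X * Poly_Mapping.single (?aT T i) 1) \<alpha>))"
    by (simp add: distrib_left lookup_add sum_distrib_left lookup_sum lookup_times_Const_times
        mult.left_commute[of ?f])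
  have fH: "?f * Poly_Mapping.lookup (?X * Poly_Mapping.single (?aH H) 1) \<alpha> =
      (if C then fact r * (\<Prod>e\<in>S H. real (Poly_Mapping.lookup \<alpha> e)) else 0)" if "H \<in> Hs" for H
    using that lookup_power_sum_Var_times_single[OF finite_I, of "?aH H" \<alpha> r]
    by (simp add: keys_squarefree_exponent finite_S S_subset total_degree_on_squarefree finite_I card_S
        falling_power_squarefree C_def)
  have fT: "?f * Poly_Mapping.lookup (?X * Poly_Mapping.single (?aT T i) 1) \<alpha> =
      (if C then fact r * ((real (Poly_Mapping.lookup \<alpha> i) - (if i \<in> B T then 1 else 0)) *
        (\<Prod>e\<in>B T. real (Poly_Mapping.lookup \<alpha> e))) else 0)" if "T \<in> Ts" "i \<in> I" for T i
  proof -
    have "Poly_Mapping.keys (?aT T i) \<subseteq> I"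
      using that B_subset[of T] finite_B[of T]
      by (auto simp: in_keys_iff lookup_add lookup_single when_def lookup_squarefree_exponent
          split: if_splits)
    then show ?thesis
      using that lookup_power_sum_Var_times_single[OF finite_I, of "?aT T i" \<alpha> r]
      by (simp add: B_subset total_degree_on_add total_degree_on_single total_degree_on_squarefree
          finite_I card_B falling_power_single_plus_squarefree C_def del: One_nat_def)
  qed
  have "?f * Poly_Mapping.lookup (?X * F_poly m c) \<alpha> =
      (\<Sum>H\<in>Hs. c H * (if C then fact r * (\<Prod>e\<in>S H. real (Poly_Mapping.lookup \<alpha> e)) else 0)) +
      (\<Sum>T\<in>Ts. \<Sum>i\<in>I. m i * (if C then fact r *
        ((real (Poly_Mapping.lookup \<alpha> i) - (if i \<in> B T then 1 else 0)) *
        (\<Prod>e\<in>B T. real (Poly_Mapping.lookup \<alpha> e))) else 0))"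
    unfolding eq by (simp only: fH fT cong: sum.cong)
  then show ?thesis
    unfolding C_def[symmetric]
    by (cases C) (simp_all add: sum_distrib_left distrib_left mult_ac cong: sum.cong)
qed

text \<open>
  On vectors supported on the complement of a tree avoiding \<open>e\<close>, all 2-forest monomials vanish and
  \<open>F = (m\<^sub>1 u\<^sub>1 + \<dots> + m\<^sub>n u\<^sub>n)\<cdot>U\<close> with \<open>U > 0\<close>. Letting the coordinate \<open>u\<^sub>e = t\<close> grow isolates \<open>m\<^sub>e\<close>.
\<close>

lemma strictly_copositive_imp_mass_pos:
  assumes "strictly_copositive m c" "e \<in> I"
  shows "m e > 0"
proof -
  obtain \<delta> where \<delta>: "\<delta> > 0"
    "\<And>u. (\<forall>e\<in>I. u e \<ge> 0) \<Longrightarrow> \<delta> * (\<Sum>e\<in>I. u e) * U_val u \<le> F_val m c u"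
    using assms(1) unfolding strictly_copositive_def by blast
  obtain T where T: "T \<in> Ts" "e \<in> B T"
  proof -
    obtain T0 where T0: "T0 \<in> Ts" using Ts_nonempty by blast
    then show ?thesis
      using exchange[OF T0, of e] assms(2) that by (cases "e \<in> B T0") auto
  qed
  define M where "M = (\<Sum>i\<in>B T - {e}. m i)"
  have bound: "\<delta> * t \<le> m e * t + M" if t: "t > 0" for t
  proof -
    define u where "u = (\<lambda>i. if i = e then t else if i \<in> B T then 1 else 0)"
    have u0: "u i = 0 \<longleftrightarrow> i \<notin> B T" for i
      using t T(2) by (auto simp: u_def)
    have fin: "finite (B T)" by (rule finite_B[OF T(1)])
    have pos: "(\<Prod>i\<in>B T. u i) > 0"
      using t by (intro prod_pos) (auto simp: u_def)
    have forest: "(\<Prod>i\<in>S H. u i) = 0" if "H \<in> Hs" for H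
      using S_not_subset_B[OF that T(1)] finite_S[OF that] u0 by (auto intro!: prod_zero)
    have tree: "(\<Prod>i\<in>B T'. u i) = (if B T' = B T then \<Prod>i\<in>B T. u i else 0)" if "T' \<in> Ts" for T'
      using B_antichain[OF that T(1)] finite_B[OF that] u0 by (auto intro!: prod_zero)
    have "U_val u \<ge> (\<Prod>i\<in>B T. u i)"
      unfolding U_val_def using t finite_Ts T(1)
      by (intro member_le_sum prod_nonneg) (auto simp: u_def)
    then have U: "U_val u > 0" using pos by simp
    have lin: "(\<Sum>i\<in>I. f i * u i) = f e * t + (\<Sum>i\<in>B T - {e}. f i)" for f :: "nat \<Rightarrow> real"
    proof -
      have "(\<Sum>i\<in>I. f i * u i) = (\<Sum>i\<in>B T. f i * u i)"
        using u0 B_subset[OF T(1)] finite_I by (intro sum.mono_neutral_right) auto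
      also have "\<dots> = f e * t + (\<Sum>i\<in>B T - {e}. f i * u i)"
        using fin T(2) by (simp add: sum.remove u_def)
      also have "(\<Sum>i\<in>B T - {e}. f i * u i) = (\<Sum>i\<in>B T - {e}. f i)"
        by (intro sum.cong) (auto simp: u_def)
      finally show ?thesis .
    qed
    have "\<delta> * (\<Sum>i\<in>I. u i) * U_val u \<le> F_val m c u"
      by (rule \<delta>(2)) (use t in \<open>auto simp: u_def\<close>)
    also have "F_val m c u = (m e * t + M) * U_val u"
      by (simp add: F_val_def forest lin M_def)
    finally have "\<delta> * (\<Sum>i\<in>I. u i) \<le> m e * t + M"
      using U by simp
    moreover have "(\<Sum>i\<in>I. u i) \<ge> t"
      using lin[of "\<lambda>_. 1"] by simp
    ultimately show ?thesis
      using \<delta>(1) by (meson mult_left_mono less_imp_le order_trans)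
  qed
  show ?thesis
  proof (rule ccontr)
    assume "\<not> m e > 0"
    then have "\<delta> * t \<le> M" if "t > 0" for t
      using bound[OF that] that by (smt (verit) mult_nonneg_nonneg mult_minus_left)
    from this[of "\<bar>M\<bar> / \<delta> + 1"] have "\<delta> * (\<bar>M\<bar> / \<delta> + 1) \<le> M"
      using \<delta>(1) by (simp add: add_nonneg_pos)
    then show False
      using \<delta>(1) by (simp add: distrib_left)
  qed
qed

text \<open>
  Replacing powers of \<open>\<alpha>\<close> by falling powers in \<open>F(\<alpha>)\<close> loses at most \<open>M\<cdot>U(\<alpha>)\<close>, which strict
  copositivity compensates as soon as \<open>\<delta>\<cdot>r \<ge> M\<close>.
\<close>

lemma strictly_copositive_imp_Polya:
  assumes "strictly_copositive m c"
  shows "\<exists>r::nat. only_positive_coeffs ((\<Sum>e\<in>I. Var e) ^ r * F_poly m c)"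
proof -
  obtain \<delta> where \<delta>: "\<delta> > 0"
    "\<And>u. (\<forall>e\<in>I. u e \<ge> 0) \<Longrightarrow> \<delta> * (\<Sum>e\<in>I. u e) * U_val u \<le> F_val m c u"
    using assms(1) unfolding strictly_copositive_def by blast
  define M where "M = (\<Sum>i\<in>I. \<bar>m i\<bar>)"
  obtain r :: nat where r: "M / \<delta> \<le> real r"
    using real_arch_simple by blast
  have "Poly_Mapping.lookup ((\<Sum>e\<in>I. Var e) ^ r * F_poly m c) \<alpha> \<ge> 0" for \<alpha>
  proof -
    let ?u = "\<lambda>i. real (Poly_Mapping.lookup \<alpha> i)"
    let ?E = "(\<Sum>H\<in>Hs. c H * (\<Prod>e\<in>S H. ?u e)) +
         (\<Sum>T\<in>Ts. \<Sum>i\<in>I. m i * ((?u i - (if i \<in> B T then 1 else 0)) * (\<Prod>e\<in>B T. ?u e)))"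
    have f: "factorial_exponent I \<alpha> > 0"
      unfolding factorial_exponent_def by (intro prod_pos) auto
    have "0 \<le> ?E" if deg: "total_degree_on I \<alpha> = r + Suc d"
    proof -
      have U: "U_val ?u \<ge> 0" by (rule U_val_nonneg) auto
      have tree: "(\<Sum>i\<in>I. m i * ((?u i - (if i \<in> B T then 1 else 0)) * P)) \<ge> ((\<Sum>i\<in>I. m i * ?u i) - M) * P"
        if "P \<ge> 0" for T P
      proof -
        have "(\<Sum>i\<in>I. m i * ((?u i - (if i \<in> B T then 1 else 0)) * P)) =
            (\<Sum>i\<in>I. m i * (?u i - (if i \<in> B T then 1 else 0))) * P"
          by (simp add: sum_distrib_right mult.assoc)
        moreover have "(\<Sum>i\<in>I. m i * ?u i) - M \<le> (\<Sum>i\<in>I. m i * (?u i - (if i \<in> B T then 1 else 0)))"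
          unfolding M_def sum_subtractf[symmetric] by (intro sum_mono) (auto simp: algebra_simps)
        ultimately show ?thesis
          using that by (simp add: mult_right_mono)
      qed
      have "(\<Sum>T\<in>Ts. \<Sum>i\<in>I. m i * ((?u i - (if i \<in> B T then 1 else 0)) * (\<Prod>e\<in>B T. ?u e)))
          \<ge> (\<Sum>T\<in>Ts. ((\<Sum>i\<in>I. m i * ?u i) - M) * (\<Prod>e\<in>B T. ?u e))"
        by (intro sum_mono tree prod_nonneg) auto
      also have "(\<Sum>T\<in>Ts. ((\<Sum>i\<in>I. m i * ?u i) - M) * (\<Prod>e\<in>B T. ?u e)) =
          ((\<Sum>i\<in>I. m i * ?u i) - M) * U_val ?u"
        by (simp add: U_val_def sum_distrib_left)
      finally have "?E \<ge> F_val m c ?u - M * U_val ?u"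
        by (simp add: F_val_def algebra_simps)
      moreover have "F_val m c ?u \<ge> \<delta> * (\<Sum>i\<in>I. ?u i) * U_val ?u"
        by (rule \<delta>(2)) auto
      moreover have "M * U_val ?u \<le> \<delta> * (\<Sum>i\<in>I. ?u i) * U_val ?u"
      proof -
        have "(\<Sum>i\<in>I. ?u i) \<ge> real r"
          using deg by (simp add: total_degree_on_def flip: of_nat_sum)
        then have "M \<le> \<delta> * (\<Sum>i\<in>I. ?u i)"
          using r \<delta>(1) by (smt (verit) mult_left_mono divide_le_eq mult.commute)
        then show ?thesis
          using U by (rule mult_right_mono)
      qed
      ultimately show ?thesis by linarith
    qed
    then have "factorial_exponent I \<alpha> * Poly_Mapping.lookup ((\<Sum>e\<in>I. Var e) ^ r * F_poly m c) \<alpha> \<ge> 0"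
      unfolding lookup_power_times_F_poly by auto
    then show ?thesis
      using f by (simp add: zero_le_mult_iff)
  qed
  then show ?thesis
    unfolding only_positive_coeffs_def by (metis in_keys_iff order_le_less)
qed

text \<open>
  The exponent \<open>\<alpha>\<close> is supported on \<open>B T\<close>, which contains no \<open>S H\<close>; so the 2-forest terms,
  whose coefficients can have either sign, vanish. Of the others, the term of \<open>T\<close> and \<open>i\<close> is positive.
\<close>

lemma coeff_power_times_F_poly_pos:
  assumes m: "\<And>e. e \<in> I \<Longrightarrow> m e > 0" and T: "T \<in> Ts" and i: "i \<in> B T"
  shows "Poly_Mapping.lookup ((\<Sum>e\<in>I. Var e) ^ r * F_poly m c)
    (Poly_Mapping.single i (Suc r) + squarefree_exponent (B T)) > 0"
proof -
  define \<alpha> where "\<alpha> = Poly_Mapping.single i (Suc r) + squarefree_exponent (B T)"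
  let ?u = "\<lambda>i. real (Poly_Mapping.lookup \<alpha> i)"
  have iI: "i \<in> I" using B_subset T i by blast
  have fin: "finite (B T)" by (rule finite_B[OF T])
  have u: "?u j = (if j = i then real r + 2 else if j \<in> B T then 1 else 0)" for j
    using i fin by (auto simp: \<alpha>_def lookup_add lookup_single when_def lookup_squarefree_exponent)
  have keys: "Poly_Mapping.keys \<alpha> \<subseteq> I"
  proof
    fix j assume "j \<in> Poly_Mapping.keys \<alpha>"
    then have "?u j \<noteq> 0" by (simp add: in_keys_iff)
    then show "j \<in> I"
      using u[of j] iI B_subset[OF T] by (auto split: if_splits)
  qed
  have deg: "total_degree_on I \<alpha> = r + Suc d"
    using iI B_subset[OF T] card_B[OF T]
    by (simp add: \<alpha>_def total_degree_on_add total_degree_on_single total_degree_on_squarefree finite_I)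
  let ?t = "\<lambda>T j. m j * ((?u j - (if j \<in> B T then 1 else 0)) * (\<Prod>e\<in>B T. ?u e))"
  have forest: "(\<Prod>e\<in>S H. ?u e) = 0" if H: "H \<in> Hs" for H
  proof -
    obtain e where "e \<in> S H" "e \<notin> B T"
      using S_not_subset_B[OF H T] by blast
    moreover have "?u e = 0" using calculation i u by auto
    ultimately show ?thesis
      using finite_S[OF H] by (intro prod_zero) auto
  qed
  \<comment> \<open>If \<open>\<alpha>\<close> vanishes at \<open>j \<in> B T'\<close>, the first factor is \<open>-1\<close>, but then the product is \<open>0\<close>.\<close>
  have nonneg: "?t T' j \<ge> 0" if "T' \<in> Ts" "j \<in> I" for T' j
  proof (cases "j \<in> B T' \<and> Poly_Mapping.lookup \<alpha> j = 0")
    case True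
    then have "(\<Prod>e\<in>B T'. ?u e) = 0"
      using finite_B[OF that(1)] by (intro prod_zero) auto
    then show ?thesis by simp
  next
    case False
    then have "?u j - (if j \<in> B T' then 1 else 0) \<ge> 0" by auto
    then show ?thesis
      using m[OF that(2)] by (intro mult_nonneg_nonneg prod_nonneg) auto
  qed
  have "(\<Prod>e\<in>B T. ?u e) > 0"
    by (intro prod_pos) (auto simp: u)
  then have "0 < ?t T i"
    using m[OF iI] u[of i] i by simp
  also have "\<dots> \<le> (\<Sum>j\<in>I. ?t T j)"
    using nonneg[OF T] iI finite_I by (intro member_le_sum) auto
  also have "\<dots> \<le> (\<Sum>T'\<in>Ts. \<Sum>j\<in>I. ?t T' j)"
    using nonneg T finite_Ts by (intro member_le_sum[of T Ts "\<lambda>T'. \<Sum>j\<in>I. ?t T' j"] sum_nonneg) auto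
  finally have pos: "(\<Sum>T'\<in>Ts. \<Sum>j\<in>I. ?t T' j) > 0" .
  have "factorial_exponent I \<alpha> * Poly_Mapping.lookup ((\<Sum>e\<in>I. Var e) ^ r * F_poly m c) \<alpha> =
      fact r * (\<Sum>T'\<in>Ts. \<Sum>j\<in>I. ?t T' j)"
    unfolding lookup_power_times_F_poly using keys deg forest by simp
  then have "factorial_exponent I \<alpha> * Poly_Mapping.lookup ((\<Sum>e\<in>I. Var e) ^ r * F_poly m c) \<alpha> > 0"
    using pos by simp
  moreover have "factorial_exponent I \<alpha> > 0"
    unfolding factorial_exponent_def by (intro prod_pos) auto
  ultimately show ?thesis
    unfolding \<alpha>_def by (simp add: zero_less_mult_iff)
qed

lemma F_val_zero:
  assumes "\<And>e. e \<in> I \<Longrightarrow> u e = 0"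
  shows "F_val m c u = 0"
proof -
  have "(\<Prod>e\<in>S H. u e) = 0" if "H \<in> Hs" for H
    using S_insert[OF that] finite_S[OF that] assms by (intro prod_zero) auto
  then show ?thesis
    using assms by (simp add: F_val_def)
qed

text \<open>
  The exchange replaces a factor \<open>u\<^sub>j\<close> of the monomial by \<open>u\<^sub>i \<ge> u\<^sub>j\<close>.
\<close>

lemma tree_avoiding_maximum:
  assumes T: "T \<in> Ts" and i: "i \<in> I"
    and u: "\<And>e. e \<in> I \<Longrightarrow> 0 \<le> u e" "\<And>e. e \<in> I \<Longrightarrow> u e \<le> u i"
  shows "\<exists>T'\<in>Ts. i \<in> B T' \<and> (\<Prod>e\<in>B T. u e) \<le> (\<Prod>e\<in>B T'. (u e :: real))"
proof (cases "i \<in> B T")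
  case False
  then obtain j T' where jT: "j \<in> B T" "T' \<in> Ts" "B T' = insert i (B T - {j})"
    using exchange[OF T, of i] i by blast
  have "(\<Prod>e\<in>B T. u e) = u j * (\<Prod>e\<in>B T - {j}. u e)"
    using finite_B[OF T] jT(1) by (simp add: prod.remove)
  also have "\<dots> \<le> u i * (\<Prod>e\<in>B T - {j}. u e)"
    using u B_subset[OF T] jT(1) by (intro mult_right_mono prod_nonneg) auto
  also have "\<dots> = (\<Prod>e\<in>B T'. u e)"
    using jT(3) finite_B[OF T] False by simp
  finally show ?thesis using jT by blast
qed (use T in blast)

text \<open>
  Here \<open>\<kappa>\<close> is a common lower bound of the coefficients from \<open>coeff_power_times_F_poly_pos\<close>. With \<open>i\<close> maximal,
  \<open>s \<le> n u\<^sub>i\<close>, so each tree term of \<open>\<kappa>\<cdot>s\<^bsup>r+1\<^esup>\<cdot>U\<close> is at most \<open>n\<^bsup>r+1\<^esup>\<close> times one term of \<open>s\<^sup>r\<cdot>F\<close>, and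
  the other terms are nonnegative.
\<close>

lemma Polya_imp_strictly_copositive:
  assumes m: "\<And>e. e \<in> I \<Longrightarrow> m e > 0"
    and pos: "only_positive_coeffs ((\<Sum>e\<in>I. Var e) ^ r * F_poly m c)"
  shows "strictly_copositive m c"
proof -
  let ?P = "(\<Sum>e\<in>I. Var e) ^ r * F_poly m c"
  let ?a = "\<lambda>T i. Poly_Mapping.single i (Suc r) + squarefree_exponent (B T)"
  let ?n = "real (card I)"
  define L where "L = (\<lambda>(T, i). Poly_Mapping.lookup ?P (?a T i)) ` (SIGMA T:Ts. B T)"
  define \<kappa> where "\<kappa> = Min (insert 1 L)"
  have finL: "finite L"
    unfolding L_def using finite_Ts finite_B by auto
  have "\<kappa> > 0"
    unfolding \<kappa>_def using finL coeff_power_times_F_poly_pos[OF m] by (auto simp: L_def)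
  have \<kappa>_le: "\<kappa> \<le> Poly_Mapping.lookup ?P (?a T i)" if "T \<in> Ts" "i \<in> B T" for T i
    unfolding \<kappa>_def using finL that by (intro Min_le) (auto simp: L_def)
  define D where "D = ?n ^ Suc r * real (card Ts)"
  have D: "D \<ge> 0" by (simp add: D_def)
  \<comment> \<open>\<open>D + 1\<close> instead of \<open>D\<close>, because \<open>D = 0\<close> if there are no variables.\<close>
  define \<delta> where "\<delta> = \<kappa> / (D + 1)"
  have "\<delta> > 0" using \<open>\<kappa> > 0\<close> D by (simp add: \<delta>_def)
  moreover have "\<delta> * (\<Sum>e\<in>I. u e) * U_val u \<le> F_val m c u" if u0: "\<forall>e\<in>I. u e \<ge> 0" for u
  proof (cases "\<forall>e\<in>I. u e = 0")
    case True
    then show ?thesis using F_val_zero[of u m c] by simp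
  next
    case False
    \<comment> \<open>Coordinates outside \<open>I\<close> are unconstrained; setting them to \<open>0\<close> makes every monomial nonnegative.\<close>
    define v where "v = (\<lambda>e. if e \<in> I then u e else 0)"
    have v0: "v e \<ge> 0" for e using u0 by (simp add: v_def)
    have Fv: "F_val m c v = F_val m c u" and Uv: "U_val v = U_val u" and sv: "(\<Sum>e\<in>I. v e) = (\<Sum>e\<in>I. u e)"
    proof -
      show "(\<Sum>e\<in>I. v e) = (\<Sum>e\<in>I. u e)"
        by (simp add: v_def)
      show U: "U_val v = U_val u"
        unfolding U_val_def using B_subset by (intro sum.cong prod.cong) (auto simp: v_def)
      have "(\<Prod>e\<in>S H. v e) = (\<Prod>e\<in>S H. u e)" if "H \<in> Hs" for H
        using S_subset[OF that] by (intro prod.cong) (auto simp: v_def)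
      then show "F_val m c v = F_val m c u"
        unfolding F_val_def U by (simp add: v_def cong: sum.cong)
    qed
    have "I \<noteq> {}" using False by blast
    then obtain i where i: "i \<in> I" "\<And>e. e \<in> I \<Longrightarrow> v e \<le> v i"
      using finite_I Max_in[of "v ` I"] Max_ge[of "v ` I"] by (metis (no_types, lifting) finite_imageI image_iff image_is_empty)
    let ?s = "\<Sum>e\<in>I. v e"
    have s_le: "?s \<le> ?n * v i"
      using sum_bounded_above[of I v "v i"] i(2) by simp
    have s_pos: "?s > 0"
    proof -
      obtain e where "e \<in> I" "u e \<noteq> 0" using False by blast
      then have "v e > 0" using v0[of e] by (simp add: v_def)
      then show ?thesis using \<open>e \<in> I\<close> finite_I v0 by (intro sum_pos2) auto
    qed
    have P_eval: "eval_mpoly ?P v = ?s ^ r * F_val m c v"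
      by (simp add: eval_mpoly_simps eval_F_poly)
    have tree: "?s ^ Suc r * (\<Prod>e\<in>B T. v e) * \<kappa> \<le> ?n ^ Suc r * (?s ^ r * F_val m c v)" if T: "T \<in> Ts" for T
    proof -
      obtain T' where T': "T' \<in> Ts" "i \<in> B T'" "(\<Prod>e\<in>B T. v e) \<le> (\<Prod>e\<in>B T'. v e)"
        using tree_avoiding_maximum[OF T i(1), of v] v0 i(2) by blast
      have mono: "eval_monomial v (?a T' i) = v i ^ Suc r * (\<Prod>e\<in>B T'. v e)"
        by (simp add: eval_monomial_add keys_squarefree_exponent finite_B[OF T'(1)]
            lookup_squarefree_exponent del: power_Suc)
      have "?s ^ Suc r * (\<Prod>e\<in>B T. v e) * \<kappa> \<le> (?n * v i) ^ Suc r * (\<Prod>e\<in>B T'. v e) * \<kappa>"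
        using T'(3) s_le s_pos v0 \<open>\<kappa> > 0\<close>
        by (intro mult_right_mono mult_mono power_mono prod_nonneg) auto
      also have "\<dots> = ?n ^ Suc r * (\<kappa> * eval_monomial v (?a T' i))"
        unfolding mono by (simp only: power_mult_distrib mult_ac)
      also have "\<dots> \<le> ?n ^ Suc r * (Poly_Mapping.lookup ?P (?a T' i) * eval_monomial v (?a T' i))"
        using \<kappa>_le[OF T'(1,2)] v0 by (intro mult_left_mono mult_right_mono prod_nonneg) auto
      also have "\<dots> \<le> ?n ^ Suc r * eval_mpoly ?P v"
      proof -
        have "?a T' i \<in> Poly_Mapping.keys ?P"
          using \<kappa>_le[OF T'(1,2)] \<open>\<kappa> > 0\<close> by (auto simp: in_keys_iff)
        then have "Poly_Mapping.lookup ?P (?a T' i) * eval_monomial v (?a T' i) \<le> eval_mpoly ?P v"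
          unfolding eval_mpoly_def using pos v0
          by (intro member_le_sum[of "?a T' i" _ "\<lambda>a. Poly_Mapping.lookup ?P a * eval_monomial v a"])
             (auto simp: only_positive_coeffs_def less_imp_le intro!: mult_nonneg_nonneg prod_nonneg)
        then show ?thesis by (intro mult_left_mono) auto
      qed
      finally show ?thesis unfolding P_eval .
    qed
    have "?s ^ Suc r * U_val v * \<kappa> = (\<Sum>T\<in>Ts. ?s ^ Suc r * (\<Prod>e\<in>B T. v e) * \<kappa>)"
      by (simp add: U_val_def sum_distrib_left sum_distrib_right)
    also have "\<dots> \<le> (\<Sum>T\<in>Ts. ?n ^ Suc r * (?s ^ r * F_val m c v))"
      by (rule sum_mono) (rule tree)
    also have "\<dots> = ?s ^ r * (D * F_val m c v)"
      by (simp add: D_def)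
    finally have "?s ^ r * (\<kappa> * ?s * U_val v) \<le> ?s ^ r * (D * F_val m c v)"
      by (simp add: mult_ac)
    then have le: "\<kappa> * ?s * U_val v \<le> D * F_val m c v"
      using s_pos by simp
    have "\<kappa> * ?s * U_val v \<ge> 0"
      using \<open>\<kappa> > 0\<close> s_pos U_val_nonneg[of v] v0 by simp
    then have "D * F_val m c v \<ge> 0" using le by simp
    have "F_val m c v \<ge> 0"
    proof -
      have "D > 0"
        using \<open>I \<noteq> {}\<close> finite_I finite_Ts Ts_nonempty by (simp add: D_def card_gt_0_iff)
      then show ?thesis using \<open>D * F_val m c v \<ge> 0\<close> by (simp add: zero_le_mult_iff)
    qed
    then have "\<kappa> * ?s * U_val v \<le> (D + 1) * F_val m c v"
      using le by (simp add: algebra_simps)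
    then have "\<delta> * ?s * U_val v \<le> F_val m c v"
      using D by (simp add: \<delta>_def field_simps)
    then show ?thesis using Fv Uv sv by simp
  qed
  ultimately show ?thesis
    unfolding strictly_copositive_def by blast
qed

theorem strictly_copositive_iff_Polya:
  "strictly_copositive m c \<longleftrightarrow> (\<forall>e\<in>I. m e > 0) \<and>
    (\<exists>r::nat. only_positive_coeffs ((\<Sum>e\<in>I. Var e) ^ r * F_poly m c))"
  using strictly_copositive_imp_mass_pos strictly_copositive_imp_Polya Polya_imp_strictly_copositive
  by metis


subsection \<open>Dependence on the parameters\<close>

lemma forest_monomial_le:
  assumes "H \<in> Hs" and u: "\<And>e. e \<in> I \<Longrightarrow> u e \<ge> 0"
  shows "(\<Prod>e\<in>S H. u e) \<le> (\<Sum>e\<in>I. u e) * U_val u"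
proof -
  obtain T i where T: "T \<in> Ts" "i \<in> I - B T" "S H = insert i (B T)"
    using S_insert[OF assms(1)] by blast
  have nonneg: "(\<Prod>e\<in>B T'. u e) \<ge> 0" if "T' \<in> Ts" for T'
    using u B_subset[OF that] by (intro prod_nonneg) auto
  have "(\<Prod>e\<in>S H. u e) = u i * (\<Prod>e\<in>B T. u e)"
    using T finite_B by simp
  also have "\<dots> \<le> (\<Sum>e\<in>I. u e) * U_val u"
  proof (rule mult_mono)
    show "u i \<le> (\<Sum>e\<in>I. u e)"
      using T(2) u finite_I by (intro member_le_sum) auto
    show "(\<Prod>e\<in>B T. u e) \<le> U_val u"
      unfolding U_val_def using T(1) nonneg finite_Ts
      by (intro member_le_sum[of T Ts "\<lambda>T. \<Prod>e\<in>B T. u e"]) auto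
    show "0 \<le> (\<Sum>e\<in>I. u e)" using u by (rule sum_nonneg)
    show "0 \<le> (\<Prod>e\<in>B T. u e)" by (rule nonneg[OF T(1)])
  qed
  finally show ?thesis .
qed

lemma F_val_perturb:
  assumes u: "\<And>e. e \<in> I \<Longrightarrow> u e \<ge> 0" and c: "\<And>H. H \<in> Hs \<Longrightarrow> \<bar>c' H - c H\<bar> \<le> \<eta>"
  shows "F_val m' c' u \<ge>
    F_val m c u - (real (card Hs) * \<eta> + (\<Sum>e\<in>I. \<bar>m' e - m e\<bar>)) * (\<Sum>e\<in>I. u e) * U_val u"
proof -
  let ?s = "\<Sum>e\<in>I. u e"
  let ?\<mu> = "\<Sum>e\<in>I. \<bar>m' e - m e\<bar>"
  have U: "U_val u \<ge> 0" by (rule U_val_nonneg) (rule u)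
  have "c' H * (\<Prod>e\<in>S H. u e) \<ge> c H * (\<Prod>e\<in>S H. u e) - \<eta> * (?s * U_val u)" if H: "H \<in> Hs" for H
  proof -
    have "(c H - c' H) * (\<Prod>e\<in>S H. u e) \<le> \<bar>c' H - c H\<bar> * (\<Prod>e\<in>S H. u e)"
      using S_subset[OF H] u by (intro mult_right_mono prod_nonneg) auto
    also have "\<dots> \<le> \<eta> * (?s * U_val u)"
      using c[OF H] forest_monomial_le[OF H u] S_subset[OF H] u
      by (intro mult_mono prod_nonneg) auto
    finally show ?thesis
      by (simp add: left_diff_distrib)
  qed
  then have "(\<Sum>H\<in>Hs. c' H * (\<Prod>e\<in>S H. u e)) \<ge> (\<Sum>H\<in>Hs. c H * (\<Prod>e\<in>S H. u e) - \<eta> * (?s * U_val u))"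
    by (rule sum_mono)
  then have 1: "(\<Sum>H\<in>Hs. c' H * (\<Prod>e\<in>S H. u e)) \<ge>
      (\<Sum>H\<in>Hs. c H * (\<Prod>e\<in>S H. u e)) - real (card Hs) * \<eta> * ?s * U_val u"
    by (simp add: sum_subtractf mult.assoc)
  have "(\<Sum>e\<in>I. m e * u e) - (\<Sum>e\<in>I. m' e * u e) \<le> (\<Sum>e\<in>I. ?\<mu> * u e)"
    unfolding sum_subtractf[symmetric] left_diff_distrib[symmetric]
  proof (rule sum_mono)
    fix e assume e: "e \<in> I"
    have "m e - m' e \<le> \<bar>m' e - m e\<bar>" by simp
    also have "\<dots> \<le> ?\<mu>"
      using e finite_I by (intro member_le_sum[of e I "\<lambda>e. \<bar>m' e - m e\<bar>"]) auto
    finally show "(m e - m' e) * u e \<le> ?\<mu> * u e"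
      using u[OF e] by (rule mult_right_mono)
  qed
  then have "(\<Sum>e\<in>I. m' e * u e) \<ge> (\<Sum>e\<in>I. m e * u e) - ?\<mu> * ?s"
    by (simp add: sum_distrib_left)
  then have "(\<Sum>e\<in>I. m' e * u e) * U_val u \<ge> ((\<Sum>e\<in>I. m e * u e) - ?\<mu> * ?s) * U_val u"
    using U by (rule mult_right_mono)
  then show ?thesis
    using 1 unfolding F_val_def by (simp add: algebra_simps)
qed

end


section \<open>Forests as edge sets\<close>

definition reach :: "('e \<Rightarrow> 'v uprod) \<Rightarrow> 'e set \<Rightarrow> ('v \<times> 'v) set" where
  "reach en X = {(v, w). \<exists>e\<in>X. en e = Upair v w}\<^sup>*"

text \<open>
  Every edge is a bridge of \<open>X\<close>. For the edge set of a graph this is the absence of cycles, see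
  \<open>acyclic_mgraph_iff_forest\<close>, in a form that is convenient for exchanging edges.
\<close>

definition forest :: "('e \<Rightarrow> 'v uprod) \<Rightarrow> 'e set \<Rightarrow> bool" where
  "forest en X \<longleftrightarrow> (\<forall>e\<in>X. \<forall>a b. en e = Upair a b \<longrightarrow> (a, b) \<notin> reach en (X - {e}))"

definition spans :: "('e \<Rightarrow> 'v uprod) \<Rightarrow> 'v set \<Rightarrow> 'e set \<Rightarrow> bool" where
  "spans en V X \<longleftrightarrow> (\<forall>v\<in>V. \<forall>w\<in>V. (v, w) \<in> reach en X)"

lemma reach_refl: "(a, a) \<in> reach en X"
  by (simp add: reach_def)

lemma reach_trans: "(a, b) \<in> reach en X \<Longrightarrow> (b, c) \<in> reach en X \<Longrightarrow> (a, c) \<in> reach en X"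
  unfolding reach_def by (rule rtrancl_trans)

lemma reach_sym: "(a, b) \<in> reach en X \<Longrightarrow> (b, a) \<in> reach en X"
proof -
  have "sym {(v, w). \<exists>e\<in>X. en e = Upair v w}"
  proof (rule symI)
    fix v w assume "(v, w) \<in> {(v, w). \<exists>e\<in>X. en e = Upair v w}"
    then obtain e where "e \<in> X" "en e = Upair v w" by blast
    then have "en e = Upair w v" by simp
    then show "(w, v) \<in> {(v, w). \<exists>e\<in>X. en e = Upair v w}"
      using \<open>e \<in> X\<close> by blast
  qed
  then show "(a, b) \<in> reach en X \<Longrightarrow> (b, a) \<in> reach en X"
    unfolding reach_def by (blast dest: sym_rtrancl symD)
qed

lemma reach_edge: "e \<in> X \<Longrightarrow> en e = Upair a b \<Longrightarrow> (a, b) \<in> reach en X"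
  unfolding reach_def by (rule r_into_rtrancl) auto

lemma reach_mono: "X \<subseteq> Y \<Longrightarrow> reach en X \<subseteq> reach en Y"
  unfolding reach_def by (rule rtrancl_mono) auto

lemma reach_subset:
  assumes "\<And>e a b. e \<in> X \<Longrightarrow> en e = Upair a b \<Longrightarrow> (a, b) \<in> reach en Y"
  shows "reach en X \<subseteq> reach en Y"
proof -
  have "{(v, w). \<exists>e\<in>X. en e = Upair v w} \<subseteq> reach en Y"
    using assms by blast
  then show ?thesis
    unfolding reach_def by (rule rtrancl_subset_rtrancl)
qed

text \<open>
  A walk can be shortened so as to use the new edge at most once.
\<close>

lemma reach_insertD:
  assumes "en f = Upair a b" "(x, y) \<in> reach en (insert f X)"
  shows "(x, y) \<in> reach en X \<or> (x, a) \<in> reach en X \<and> (b, y) \<in> reach en X \<or>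
    (x, b) \<in> reach en X \<and> (a, y) \<in> reach en X"
  using assms(2) unfolding reach_def[of _ "insert f X"]
proof (induction rule: rtrancl_induct)
  case base
  then show ?case by (simp add: reach_refl)
next
  case (step y z)
  then consider e where "e \<in> X" "en e = Upair y z" | "Upair a b = Upair y z"
    using assms(1) by auto
  then show ?case
  proof cases
    case 1
    then have "(y, z) \<in> reach en X" by (rule reach_edge)
    then show ?thesis using step.IH by (meson reach_trans)
  next
    case 2
    then show ?thesis using step.IH by (auto intro: reach_refl)
  qed
qed

lemma forest_subset: "forest en Y \<Longrightarrow> X \<subseteq> Y \<Longrightarrow> forest en X"
  unfolding forest_def using reach_mono[of "X - {_}" "Y - {_}" en] by blast

text \<open>
  If an old edge \<open>e\<close> ceased to be a bridge, a detour around \<open>e\<close> would run through \<open>f\<close>. Its two pieces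
  together with \<open>e\<close> would already connect \<open>a\<close> and \<open>b\<close>.
\<close>

lemma forest_insert:
  assumes X: "forest en X" and f: "f \<notin> X" "en f = Upair a b" and ab: "(a, b) \<notin> reach en X"
  shows "forest en (insert f X)"
  unfolding forest_def
proof (intro ballI allI impI notI)
  fix e c d assume e: "e \<in> insert f X" "en e = Upair c d" and cd: "(c, d) \<in> reach en (insert f X - {e})"
  show False
  proof (cases "e = f")
    case True
    then have "(c, d) \<in> reach en X" using cd f(1) by simp
    moreover have "c = a \<and> d = b \<or> c = b \<and> d = a" using True e(2) f(2) by auto
    ultimately show False using ab reach_sym by metis
  next
    case False
    then have eX: "e \<in> X" using e by simp
    have le: "reach en (X - {e}) \<subseteq> reach en X" by (rule reach_mono) auto
    have "insert f X - {e} = insert f (X - {e})" using False by auto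
    then have "(c, d) \<in> reach en (X - {e}) \<or> (c, a) \<in> reach en (X - {e}) \<and> (b, d) \<in> reach en (X - {e}) \<or>
        (c, b) \<in> reach en (X - {e}) \<and> (a, d) \<in> reach en (X - {e})"
      using reach_insertD[of en f a b, OF f(2)] cd by metis
    moreover have "(c, d) \<notin> reach en (X - {e})"
      using X eX e(2) unfolding forest_def by blast
    moreover have "(c, d) \<in> reach en X" using reach_edge[of e X en c d, OF eX e(2)] .
    ultimately show False
      using ab le by (meson reach_sym reach_trans subsetD)
  qed
qed

lemma reach_leaves_set:
  assumes "(a, b) \<in> reach en K" "a \<in> P" "b \<notin> P"
  shows "\<exists>f\<in>K. \<exists>x y. en f = Upair x y \<and> x \<in> P \<and> y \<notin> P"
proof (rule ccontr)
  assume no: "\<not> ?thesis"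
  have "b \<in> P"
    using assms(1) unfolding reach_def
    by (induction rule: rtrancl_induct) (use assms(2) no in auto)
  then show False using assms(3) by simp
qed

lemma spans_subset:
  assumes "spans en V X" "reach en X \<subseteq> reach en Y"
  shows "spans en V Y"
  using assms unfolding spans_def by blast

text \<open>
  Removing \<open>e\<close> splits the tree into two parts, and a spanning \<open>K\<close> must contain an edge between them.
  Two choices of \<open>K\<close> are of interest: all edges but \<open>e\<close>, if \<open>e\<close> is not a bridge,
  and the edges of another spanning tree.
\<close>

lemma spanning_tree_exchange:
  assumes T: "forest en T" "spans en V T" and e: "e \<in> T" "set_uprod (en e) \<subseteq> V"
    and K: "spans en V K" "e \<notin> K" "\<And>f. f \<in> K \<Longrightarrow> set_uprod (en f) \<subseteq> V"
  shows "\<exists>f\<in>K - T. forest en (insert f (T - {e})) \<and> spans en V (insert f (T - {e}))"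
proof -
  let ?R = "T - {e}"
  obtain a b where ab: "en e = Upair a b" by (cases "en e")
  have abV: "a \<in> V" "b \<in> V" using e(2) ab by auto
  have nab: "(a, b) \<notin> reach en ?R"
    using T(1) e(1) ab unfolding forest_def by blast
  have "(a, b) \<in> reach en K" using K(1) abV unfolding spans_def by blast
  from reach_leaves_set[OF this, of "{x. (a, x) \<in> reach en ?R}"]
  obtain f x y where f: "f \<in> K" "en f = Upair x y" and ax: "(a, x) \<in> reach en ?R" and ay: "(a, y) \<notin> reach en ?R"
    using nab reach_refl by fastforce
  have nxy: "(x, y) \<notin> reach en ?R" using ax ay reach_trans by metis
  then have fT: "f \<notin> T" using f K(2) reach_edge[of f ?R en x y] by auto
  have forest: "forest en (insert f ?R)"
    by (rule forest_insert[OF forest_subset[OF T(1)] _ f(2) nxy]) (use fT in auto)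
  have Te: "T = insert e ?R" using e(1) by auto
  have yb: "(b, y) \<in> reach en ?R"
  proof -
    have "(a, y) \<in> reach en (insert e ?R)"
      using T(2) abV(1) K(3)[OF f(1)] f(2) Te unfolding spans_def by auto
    then show ?thesis
      using reach_insertD[of en e a b, OF ab] ay nab by blast
  qed
  have le: "reach en ?R \<subseteq> reach en (insert f ?R)"
    by (rule reach_mono) auto
  have "(x, y) \<in> reach en (insert f ?R)"
    by (rule reach_edge[of f _ en x y, OF _ f(2)]) simp
  then have abf: "(a, b) \<in> reach en (insert f ?R)"
    using ax yb le by (meson reach_sym reach_trans subsetD)
  have "reach en T \<subseteq> reach en (insert f ?R)"
  proof (rule reach_subset)
    fix g c d assume g: "g \<in> T" "en g = Upair c d"
    show "(c, d) \<in> reach en (insert f ?R)"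
    proof (cases "g = e")
      case True
      then have "c = a \<and> d = b \<or> c = b \<and> d = a" using g(2) ab by auto
      then show ?thesis using abf reach_sym by metis
    next
      case False
      then show ?thesis using g by (intro reach_edge) auto
    qed
  qed
  then show ?thesis
    using f(1) fT forest spans_subset[OF T(2)] by blast
qed

lemma forest_spanning_subset_eq:
  assumes T: "forest en T" "\<And>e. e \<in> T \<Longrightarrow> set_uprod (en e) \<subseteq> V"
    and T': "spans en V T'" "T' \<subseteq> T"
  shows "T' = T"
proof (rule ccontr)
  assume "T' \<noteq> T"
  then obtain e where e: "e \<in> T" "e \<notin> T'" using T'(2) by blast
  obtain a b where ab: "en e = Upair a b" by (cases "en e")
  have "(a, b) \<in> reach en T'"
    using T'(1) T(2)[OF e(1)] ab unfolding spans_def by auto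
  then have "(a, b) \<in> reach en (T - {e})"
    using reach_mono[of T' "T - {e}" en] e(2) T'(2) by blast
  then show False
    using T(1) e(1) ab unfolding forest_def by blast
qed

text \<open>
  Exchanging an edge of \<open>T\<close> outside \<open>T'\<close> for one of \<open>T'\<close> preserves the size of \<open>T\<close> and brings it closer to \<open>T'\<close>.
\<close>

lemma spanning_trees_same_card:
  assumes "finite T" "forest en T" "spans en V T" "\<And>e. e \<in> T \<Longrightarrow> set_uprod (en e) \<subseteq> V"
    and "finite T'" "forest en T'" "spans en V T'" "\<And>e. e \<in> T' \<Longrightarrow> set_uprod (en e) \<subseteq> V"
  shows "card T = card T'"
  using assms
proof (induction "card (T - T')" arbitrary: T rule: less_induct)
  case less
  show ?case
  proof (cases "T \<subseteq> T'")
    case True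
    then show ?thesis
      using forest_spanning_subset_eq[OF less.prems(6,8,3)] by simp
  next
    case False
    then obtain e where e: "e \<in> T" "e \<notin> T'" by blast
    then obtain f where f: "f \<in> T' - T" "forest en (insert f (T - {e}))" "spans en V (insert f (T - {e}))"
      using spanning_tree_exchange[OF less.prems(2,3) e(1) less.prems(4)[OF e(1)] less.prems(7) e(2) less.prems(8)]
      by blast
    have "insert f (T - {e}) - T' = (T - T') - {e}" using f(1) by auto
    then have "card (insert f (T - {e}) - T') < card (T - T')"
      using e less.prems(1) card_Diff1_less[of "T - T'" e] by simp
    then have "card (insert f (T - {e})) = card T'"
      by (rule less.hyps) (use less.prems f in auto)
    moreover have "card (insert f (T - {e})) = card T"
      using less.prems(1) e(1) f(1) by (metis Diff_iff card_insert_disjoint card_Suc_Diff1 finite_Diff)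
    ultimately show ?thesis by simp
  qed
qed

text \<open>
  Edges that are not bridges can be dropped one after the other.
\<close>

lemma spanning_forest_exists:
  assumes "finite X" "spans en V X"
  shows "\<exists>T\<subseteq>X. forest en T \<and> spans en V T"
  using assms
proof (induction X rule: finite_psubset_induct)
  case (psubset X)
  show ?case
  proof (cases "forest en X")
    case False
    then obtain e a b where e: "e \<in> X" "en e = Upair a b" "(a, b) \<in> reach en (X - {e})"
      unfolding forest_def by blast
    have "reach en X \<subseteq> reach en (X - {e})"
    proof (rule reach_subset)
      fix g c d assume g: "g \<in> X" "en g = Upair c d"
      show "(c, d) \<in> reach en (X - {e})"
      proof (cases "g = e")
        case True
        then have "c = a \<and> d = b \<or> c = b \<and> d = a" using g(2) e(2) by auto
        then show ?thesis using e(3) reach_sym by metis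
      next
        case False
        then show ?thesis using g by (intro reach_edge) auto
      qed
    qed
    then have "spans en V (X - {e})" using psubset.prems spans_subset by blast
    then show ?thesis
      using psubset.IH[of "X - {e}"] e(1) by blast
  qed (use psubset.prems in blast)
qed


section \<open>Cycle-free graphs\<close>

lemma cycle_imp_not_forest:
  assumes "is_cycle T vs es"
  shows "\<not> forest (ends T) (edges T)"
proof -
  let ?n = "length es"
  have n: "?n > 0" and len: "length vs = ?n" and d: "distinct es" and sub: "set es \<subseteq> edges T"
    and en: "\<And>i. i < ?n \<Longrightarrow> ends T (es ! i) = Upair (vs ! i) (vs ! (Suc i mod ?n))"
    using assms unfolding is_cycle_def by auto
  let ?e = "es ! (?n - 1)"
  have "(vs ! 0, vs ! i) \<in> reach (ends T) (edges T - {?e})" if "i < ?n" for i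
    using that
  proof (induction i)
    case (Suc i)
    have "es ! i \<in> edges T - {?e}"
      using Suc.prems sub d by (auto simp: nth_eq_iff_index_eq)
    moreover have "ends T (es ! i) = Upair (vs ! i) (vs ! Suc i)"
      using en[of i] Suc.prems by simp
    ultimately have "(vs ! i, vs ! Suc i) \<in> reach (ends T) (edges T - {?e})"
      by (rule reach_edge)
    then show ?case using Suc reach_trans by (metis Suc_lessD)
  qed (simp add: reach_refl)
  from this[of "?n - 1"] have "(vs ! 0, vs ! (?n - 1)) \<in> reach (ends T) (edges T - {?e})"
    using n by simp
  moreover have "?e \<in> edges T" using sub n by auto
  moreover have "ends T ?e = Upair (vs ! 0) (vs ! (?n - 1))"
    using en[of "?n - 1"] n by auto
  ultimately show ?thesis unfolding forest_def by blast
qed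

text \<open>
  A shortest walk between the ends of \<open>e\<close> that avoids \<open>e\<close> visits no vertex twice, so it closes up with \<open>e\<close> to a
  cycle. A loop is the case of the empty walk.
\<close>

lemma not_forest_imp_cycle:
  assumes "\<not> forest (ends T) (edges T)"
  shows "\<exists>vs es. is_cycle T vs es"
proof -
  obtain e a b where e: "e \<in> edges T" "ends T e = Upair a b" "(a, b) \<in> reach (ends T) (edges T - {e})"
    using assms unfolding forest_def by blast
  let ?r = "{(v, w). \<exists>g\<in>edges T - {e}. ends T g = Upair v w}"
  have "\<exists>n. (a, b) \<in> ?r ^^ n"
    using e(3) unfolding reach_def rtrancl_power .
  then obtain n where n: "(a, b) \<in> ?r ^^ n" and least: "\<And>k. (a, b) \<in> ?r ^^ k \<Longrightarrow> n \<le> k"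
    using LeastI_ex[of "\<lambda>n. (a, b) \<in> ?r ^^ n"] Least_le[of "\<lambda>n. (a, b) \<in> ?r ^^ n"] by blast
  then obtain p where p: "p 0 = a" "p n = b" "\<And>i. i < n \<Longrightarrow> (p i, p (Suc i)) \<in> ?r"
    unfolding relpow_fun_conv by blast
  have walk: "(p i, p j) \<in> ?r ^^ (j - i)" if "i \<le> j" "j \<le> n" for i j
    unfolding relpow_fun_conv using that p(3)
    by (intro exI[of _ "\<lambda>k. p (i + k)"]) auto
  have neq: "p i \<noteq> p j" if "i < j" "j \<le> n" for i j
  proof
    assume eq: "p i = p j"
    have "(a, b) \<in> ?r ^^ i O ?r ^^ (n - j)"
      using walk[of 0 i] walk[of j n] that eq p(1,2) by auto
    then have "(a, b) \<in> ?r ^^ (i + (n - j))" by (simp add: relpow_add)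
    from least[OF this] show False using that by simp
  qed
  have inj: "p i = p j \<longleftrightarrow> i = j" if "i \<le> n" "j \<le> n" for i j
    using neq[of i j] neq[of j i] that by (metis linorder_neqE_nat)
  obtain g where g: "\<And>i. i < n \<Longrightarrow> g i \<in> edges T - {e}" "\<And>i. i < n \<Longrightarrow> ends T (g i) = Upair (p i) (p (Suc i))"
  proof -
    have "\<forall>i. \<exists>h. i < n \<longrightarrow> h \<in> edges T - {e} \<and> ends T h = Upair (p i) (p (Suc i))"
      using p(3) by fastforce
    then show ?thesis using that by metis
  qed
  have inj_g: "i = j" if "i < n" "j < n" "g i = g j" for i j
  proof -
    have "Upair (p i) (p (Suc i)) = Upair (p j) (p (Suc j))"
      using g(2) that by metis
    then show ?thesis using inj that by auto
  qed
  let ?vs = "map p [0..<Suc n]" and ?es = "map g [0..<n] @ [e]"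
  have "is_cycle T ?vs ?es"
    unfolding is_cycle_def
  proof (intro conjI allI impI)
    show "distinct ?vs" using inj by (auto simp: distinct_map inj_on_def simp del: upt_Suc)
    show "distinct ?es" using inj_g g(1) by (force simp: distinct_map inj_on_def)
    show "set ?es \<subseteq> edges T" using g(1) e(1) by auto
    fix i assume i: "i < length ?es"
    show "ends T (?es ! i) = Upair (?vs ! i) (?vs ! (Suc i mod length ?es))"
    proof (cases "i < n")
      case True
      then show ?thesis using g(2)[OF True] by (simp add: nth_append del: upt_Suc)
    next
      case False
      then have "i = n" using i by simp
      then show ?thesis using e(2) p(1,2) by (simp add: nth_append del: upt_Suc)
    qed
  qed (auto simp del: upt_Suc)
  then show ?thesis by blast
qed

lemma acyclic_mgraph_iff_forest: "acyclic_mgraph T \<longleftrightarrow> forest (ends T) (edges T)"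
  unfolding acyclic_mgraph_def using cycle_imp_not_forest not_forest_imp_cycle by blast

lemma adjacency_rtrancl: "(adjacency T)\<^sup>* = reach (ends T) (edges T)"
  by (simp add: adjacency_def reach_def)

lemma connected_mgraph_iff_spans:
  "connected_mgraph T \<longleftrightarrow> verts T \<noteq> {} \<and> spans (ends T) (verts T) (edges T)"
  by (simp add: connected_mgraph_def spans_def adjacency_rtrancl)


section \<open>Spanning trees and two-forests\<close>

locale finite_connected_mgraph =
  fixes G :: "('v, 'e) mgraph"
  assumes finite_mgraph: "finite_mgraph G" and connected: "connected_mgraph G"
begin

abbreviation "V \<equiv> verts G"
abbreviation "E \<equiv> edges G"
abbreviation "en \<equiv> ends G"

lemma finite_E: "finite E"
  using finite_mgraph by (simp add: finite_mgraph_def)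

lemma ends_in_V: "e \<in> E \<Longrightarrow> set_uprod (en e) \<subseteq> V"
  using finite_mgraph by (simp add: finite_mgraph_def)

lemma spans_E: "spans en V E"
  using connected by (simp add: connected_mgraph_iff_spans)

definition with_edges :: "'e set \<Rightarrow> ('v, 'e) mgraph" where
  "with_edges X = \<lparr>verts = V, edges = X, ends = en\<rparr>"

lemma with_edges_sel [simp]:
  "verts (with_edges X) = V" "edges (with_edges X) = X" "ends (with_edges X) = en"
  by (simp_all add: with_edges_def)

lemma spanning_subgraph_eq:
  assumes "subgraph H G" "verts H = V"
  shows "H = with_edges (edges H)"
  using assms by (intro mgraph.equality) (auto simp: subgraph_def)

lemma spanning_treeD:
  assumes "T \<in> spanning_trees G"
  shows "edges T \<subseteq> E" "forest en (edges T)" "spans en V (edges T)"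
  using assms by (auto simp: spanning_trees_def subgraph_def acyclic_mgraph_iff_forest
      connected_mgraph_iff_spans)

lemma with_edges_in_spanning_trees:
  assumes "X \<subseteq> E" "forest en X" "spans en V X"
  shows "with_edges X \<in> spanning_trees G"
  using assms connected ends_in_V
  by (auto simp: spanning_trees_def subgraph_def acyclic_mgraph_iff_forest connected_mgraph_iff_spans)

lemma two_forestD:
  assumes "H \<in> spanning_two_forests G"
  shows "edges H \<subseteq> E" "forest en (edges H)" "external_edges G \<subseteq> edges H" "verts H = V" "ends H = en"
    "card (components_mgraph H) = 2"
  using assms by (auto simp: spanning_two_forests_def subgraph_def acyclic_mgraph_iff_forest)

lemma finite_spanning_trees: "finite (spanning_trees G)"
proof -
  have "H \<in> with_edges ` Pow E" if H: "H \<in> spanning_trees G" for H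
  proof
    show "H = with_edges (edges H)"
      using H by (intro spanning_subgraph_eq) (auto simp: spanning_trees_def)
    show "edges H \<in> Pow E" using spanning_treeD(1)[OF H] by simp
  qed
  then have "spanning_trees G \<subseteq> with_edges ` Pow E" by blast
  then show ?thesis using finite_E finite_subset by blast
qed

lemma finite_spanning_two_forests: "finite (spanning_two_forests G)"
proof -
  have "H \<in> with_edges ` Pow E" if H: "H \<in> spanning_two_forests G" for H
  proof
    show "H = with_edges (edges H)"
      using H by (intro spanning_subgraph_eq) (auto simp: spanning_two_forests_def)
    show "edges H \<in> Pow E" using two_forestD(1)[OF H] by simp
  qed
  then have "spanning_two_forests G \<subseteq> with_edges ` Pow E" by blast
  then show ?thesis using finite_E finite_subset by blast
qed

lemma spanning_trees_nonempty: "spanning_trees G \<noteq> {}"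
  using spanning_forest_exists[OF finite_E spans_E] with_edges_in_spanning_trees by blast

lemma card_spanning_tree_eq:
  assumes "T \<in> spanning_trees G" "T' \<in> spanning_trees G"
  shows "card (edges T) = card (edges T')"
proof (rule spanning_trees_same_card)
  show "finite (edges T)" "finite (edges T')"
    using spanning_treeD(1)[OF assms(1)] spanning_treeD(1)[OF assms(2)] finite_E finite_subset by blast+
  show "set_uprod (en e) \<subseteq> V" if "e \<in> edges T" for e
    using that spanning_treeD(1)[OF assms(1)] ends_in_V by blast
  show "set_uprod (en e) \<subseteq> V" if "e \<in> edges T'" for e
    using that spanning_treeD(1)[OF assms(2)] ends_in_V by blast
qed (use spanning_treeD[OF assms(1)] spanning_treeD[OF assms(2)] in auto)

text \<open>
  The only way out of a vertex of valency 1 is its edge. That edge is not a loop, as loops count twice.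
\<close>

lemma external_edge_in_spanning_tree:
  assumes T: "T \<in> spanning_trees G" and e: "e \<in> external_edges G"
  shows "e \<in> edges T"
proof -
  obtain v where eE: "e \<in> E" and v: "v \<in> set_uprod (en e)" and val: "valency G v = 1"
    using e by (auto simp: external_edges_def)
  let ?A = "{f \<in> E. v \<in> set_uprod (en f)}" and ?L = "{f \<in> E. en f = Upair v v}"
  have fin: "finite ?A" "finite ?L" using finite_E by auto
  have "card ?A > 0" using fin(1) eE v by (auto simp: card_gt_0_iff)
  then have cA: "card ?A = 1" and cL: "card ?L = 0"
    using val unfolding valency_def by linarith+
  have only: "f = e" if "f \<in> E" "v \<in> set_uprod (en f)" for f
  proof -
    obtain x where "?A = {x}" using cA by (auto simp: card_1_singleton_iff)
    then have "f \<in> {x}" "e \<in> {x}" using that eE v by blast+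
    then show ?thesis by simp
  qed
  obtain w where w: "en e = Upair v w"
    using v by (cases "en e") auto
  have "w \<noteq> v" using cL fin(2) w eE by auto
  have "(v, w) \<in> reach en (edges T)"
    using spanning_treeD(3)[OF T] ends_in_V[OF eE] w unfolding spans_def by auto
  then obtain f x y where "f \<in> edges T" "en f = Upair x y" "x \<in> {v}" "y \<notin> {v}"
    using reach_leaves_set[of v w en "edges T" "{v}"] \<open>w \<noteq> v\<close> by blast
  then have "f = e" using only spanning_treeD(1)[OF T] by auto
  then show ?thesis using \<open>f \<in> edges T\<close> by simp
qed

text \<open>
  An edge joining the two components is internal, because a 2-forest contains all external edges.
\<close>

lemma two_forest_extends_to_tree:
  assumes H: "H \<in> spanning_two_forests G"
  shows "\<exists>f\<in>internal_edges G. f \<notin> edges H \<and> with_edges (insert f (edges H)) \<in> spanning_trees G"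
proof -
  note HD = two_forestD[OF H]
  let ?X = "edges H"
  have comp_eq: "component_of H x = component_of H y" if "(x, y) \<in> reach en ?X" for x y
  proof -
    have "(x, w) \<in> reach en ?X \<longleftrightarrow> (y, w) \<in> reach en ?X" for w
      using that reach_trans reach_sym by metis
    then show ?thesis by (simp add: component_of_def adjacency_rtrancl HD(5))
  qed
  have comp_neq: "(x, y) \<in> reach en ?X" if "component_of H x = component_of H y" "y \<in> V" for x y
  proof -
    have "y \<in> verts (component_of H y)"
      using that(2) by (simp add: component_of_def adjacency_rtrancl HD(4,5) reach_refl Let_def)
    then have "y \<in> verts (component_of H x)" using that(1) by simp
    then show ?thesis by (simp add: component_of_def adjacency_rtrancl HD(5) Let_def)
  qed
  obtain C D where CD: "components_mgraph H = {C, D}" "C \<noteq> D"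
    using HD(6) by (auto simp: card_2_iff)
  then obtain p q where pq: "p \<in> V" "q \<in> V" "component_of H p \<noteq> component_of H q"
  proof -
    have "C \<in> component_of H ` V" "D \<in> component_of H ` V"
      using CD(1) unfolding components_mgraph_def HD(4) by auto
    then show ?thesis using that CD(2) by auto
  qed
  have "(p, q) \<in> reach en E" using spans_E pq unfolding spans_def by blast
  then obtain f x y where f: "f \<in> E" "en f = Upair x y"
    and px: "(p, x) \<in> reach en ?X" and npy: "(p, y) \<notin> reach en ?X"
    using reach_leaves_set[of p q en E "{x. (p, x) \<in> reach en ?X}"] reach_refl comp_eq pq(3) by fastforce
  have nxy: "(x, y) \<notin> reach en ?X" using px npy reach_trans by metis
  have fX: "f \<notin> ?X" using nxy reach_edge[of f _ en x y, OF _ f(2)] by blast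
  have xyV: "x \<in> V" "y \<in> V" using ends_in_V[OF f(1)] f(2) by auto
  have cover: "(x, w) \<in> reach en ?X \<or> (y, w) \<in> reach en ?X" if w: "w \<in> V" for w
  proof -
    have "component_of H x \<noteq> component_of H y" using comp_neq xyV nxy by blast
    moreover have "{component_of H x, component_of H y, component_of H w} \<subseteq> {C, D}"
      using xyV w unfolding CD(1)[symmetric] components_mgraph_def HD(4) by blast
    ultimately have "component_of H w = component_of H x \<or> component_of H w = component_of H y"
      by auto
    then show ?thesis using comp_neq w by metis
  qed
  let ?T = "insert f ?X"
  have le: "reach en ?X \<subseteq> reach en ?T" by (rule reach_mono) auto
  have xy: "(x, y) \<in> reach en ?T" by (rule reach_edge[of f _ en x y, OF _ f(2)]) simp
  have fromx: "(x, w) \<in> reach en ?T" if "w \<in> V" for w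
    using cover[OF that] le xy by (meson reach_trans subsetD)
  have "spans en V ?T"
    unfolding spans_def using fromx reach_sym reach_trans by meson
  moreover have "forest en ?T"
    by (rule forest_insert[OF HD(2) fX f(2) nxy])
  ultimately have "with_edges ?T \<in> spanning_trees G"
    using HD(1) f(1) by (intro with_edges_in_spanning_trees) auto
  moreover have "f \<in> internal_edges G"
    using f(1) fX HD(3) by (auto simp: internal_edges_def)
  ultimately show ?thesis using fX by blast
qed

lemma spanning_tree_exchange_internal:
  assumes T: "T \<in> spanning_trees G" and e: "e \<in> internal_edges G" "e \<in> edges T"
    and nb: "connected_mgraph (delete_edge G e)"
  shows "\<exists>f\<in>internal_edges G. f \<notin> edges T \<and> with_edges (insert f (edges T - {e})) \<in> spanning_trees G"
proof -
  note TD = spanning_treeD[OF T]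
  have K: "spans en V (E - {e})"
    using nb by (simp add: connected_mgraph_iff_spans delete_edge_def)
  have eE: "e \<in> E" using e(1) by (simp add: internal_edges_def)
  obtain f where f: "f \<in> (E - {e}) - edges T" "forest en (insert f (edges T - {e}))"
      "spans en V (insert f (edges T - {e}))"
    using spanning_tree_exchange[OF TD(2,3) e(2) ends_in_V[OF eE] K] ends_in_V by blast
  have "with_edges (insert f (edges T - {e})) \<in> spanning_trees G"
    using f TD(1) by (intro with_edges_in_spanning_trees) auto
  moreover have "f \<in> internal_edges G"
    using f(1) external_edge_in_spanning_tree[OF T] by (auto simp: internal_edges_def)
  ultimately show ?thesis using f(1) by blast
qed

end


section \<open>The exchange system of a Feynman graph\<close>

definition missing_labels :: "('v, 'e) feynman \<Rightarrow> ('v, 'e) mgraph \<Rightarrow> nat set" where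
  "missing_labels G H = {e \<in> {1..num_int G}. int_edge G e \<notin> edges H}"

text \<open>
  Spanning trees contain all external edges, so every edge missing in one is internal and has a label;
  for this reason counting labels is the same as counting edges, and the edge taken over in an exchange has a label.
\<close>

lemma feynman_symanzik_system:
  assumes G: "feynman_graph G" and nb: "bridgeless G"
  shows "\<exists>d. symanzik_system {1..num_int G} (spanning_trees (graph G)) (spanning_two_forests (graph G))
    (missing_labels G) (missing_labels G) d"
proof -
  interpret finite_connected_mgraph "graph G"
    using G by unfold_locales (auto simp: feynman_graph_def)
  let ?I = "{1..num_int G}" and ?B = "missing_labels G"
  have bij: "bij_betw (int_edge G) ?I (internal_edges (graph G))"
    using G by (simp add: feynman_graph_def)
  have inj: "int_edge G i = int_edge G j \<longleftrightarrow> i = j" if "i \<in> ?I" "j \<in> ?I" for i j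
    using bij_betw_imp_inj_on[OF bij] that by (meson inj_on_eq_iff)
  have internal: "int_edge G i \<in> internal_edges (graph G)" if "i \<in> ?I" for i
    using bij that by (rule bij_betwE[THEN bspec])
  have label: "\<exists>i\<in>?I. int_edge G i = f" if "f \<in> internal_edges (graph G)" for f
    using bij that by (metis bij_betw_imp_surj_on imageE)
  have card_missing: "card (?B T) = card E - card (edges T)" if T: "T \<in> spanning_trees (graph G)" for T
  proof -
    have "int_edge G ` ?B T = E - edges T"
    proof
      show "int_edge G ` ?B T \<subseteq> E - edges T"
        using internal by (auto simp: missing_labels_def internal_edges_def)
      show "E - edges T \<subseteq> int_edge G ` ?B T"
      proof
        fix f assume f: "f \<in> E - edges T"
        then have "f \<in> internal_edges (graph G)"
          using external_edge_in_spanning_tree[OF T] by (auto simp: internal_edges_def)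
        then show "f \<in> int_edge G ` ?B T"
          using label[of f] f by (auto simp: missing_labels_def)
      qed
    qed
    moreover have "inj_on (int_edge G) (?B T)"
      using inj by (auto simp: inj_on_def missing_labels_def)
    ultimately have "card (?B T) = card (E - edges T)"
      by (metis card_image)
    then show ?thesis
      using spanning_treeD(1)[OF T] finite_E by (simp add: card_Diff_subset finite_subset)
  qed
  obtain T0 where T0: "T0 \<in> spanning_trees (graph G)"
    using spanning_trees_nonempty by blast
  show ?thesis
  proof (intro exI[of _ "card (?B T0)"], unfold_locales)
    show "finite ?I" by simp
    show "finite (spanning_trees (graph G))" by (rule finite_spanning_trees)
    show "finite (spanning_two_forests (graph G))" by (rule finite_spanning_two_forests)
    show "spanning_trees (graph G) \<noteq> {}" by (rule spanning_trees_nonempty)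
    show "?B T \<subseteq> ?I" for T by (auto simp: missing_labels_def)
    show "card (?B T) = card (?B T0)" if T: "T \<in> spanning_trees (graph G)" for T
      using card_missing[OF T] card_missing[OF T0] card_spanning_tree_eq[OF T T0] by simp
    show "\<exists>T\<in>spanning_trees (graph G). \<exists>i\<in>?I - ?B T. ?B H = insert i (?B T)"
      if H: "H \<in> spanning_two_forests (graph G)" for H
    proof -
      obtain f where f: "f \<in> internal_edges (graph G)" "f \<notin> edges H"
          and T: "with_edges (insert f (edges H)) \<in> spanning_trees (graph G)"
        using two_forest_extends_to_tree[OF H] by blast
      obtain i where i: "i \<in> ?I" "int_edge G i = f" using label[OF f(1)] by blast
      have "?B H = insert i (?B (with_edges (insert f (edges H))))"
        using i f(2) inj by (auto simp: missing_labels_def)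
      moreover have "i \<in> ?I - ?B (with_edges (insert f (edges H)))"
        using i by (auto simp: missing_labels_def)
      ultimately show ?thesis using T by blast
    qed
    show "\<exists>j\<in>?B T. \<exists>T'\<in>spanning_trees (graph G). ?B T' = insert i (?B T - {j})"
      if T: "T \<in> spanning_trees (graph G)" and i: "i \<in> ?I - ?B T" for T i
    proof -
      let ?e = "int_edge G i"
      have e: "?e \<in> internal_edges (graph G)" "?e \<in> edges T"
        using i internal by (auto simp: missing_labels_def)
      have "connected_mgraph (delete_edge (graph G) ?e)"
        using nb e(1) by (simp add: bridgeless_def)
      then obtain f where f: "f \<in> internal_edges (graph G)" "f \<notin> edges T"
          and T': "with_edges (insert f (edges T - {?e})) \<in> spanning_trees (graph G)"
        using spanning_tree_exchange_internal[OF T e] by blast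
      obtain j where j: "j \<in> ?I" "int_edge G j = f" using label[OF f(1)] by blast
      have "?B (with_edges (insert f (edges T - {?e}))) = insert i (?B T - {j})"
        using i j f(2) e(2) inj by (auto simp: missing_labels_def)
      moreover have "j \<in> ?B T" using j f(2) by (simp add: missing_labels_def)
      ultimately show ?thesis using T' by blast
    qed
  qed
qed


section \<open>The interior of the copositive cone\<close>

text \<open>
  The arbitrary order of the two components is chosen independently of \<open>k\<close>, so the coefficient is linear in \<open>k\<close>.
\<close>

lemma momentum_coeff_diff_le:
  "\<bar>momentum_coeff G k' H - momentum_coeff G k H\<bar> \<le>
    (\<Sum>i=1..num_ext G. \<Sum>j=1..num_ext G. \<bar>k' i j - k i j\<bar>)"
proof -
  obtain A B where AB: "(SOME (T1, T2). components_mgraph H = {T1, T2}) = (A, B)"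
    by (cases "SOME (T1, T2). components_mgraph H = {T1, T2}")
  let ?a = "ext_labels G A" and ?b = "ext_labels G B"
  have sub: "?a \<subseteq> {1..num_ext G}" "?b \<subseteq> {1..num_ext G}"
    by (auto simp: ext_labels_def)
  have "momentum_coeff G k' H - momentum_coeff G k H = (\<Sum>i\<in>?a. \<Sum>j\<in>?b. k' i j - k i j)"
    by (simp add: momentum_coeff_def AB sum_subtractf)
  also have "\<bar>\<dots>\<bar> \<le> (\<Sum>i\<in>?a. \<Sum>j\<in>?b. \<bar>k' i j - k i j\<bar>)"
    by (rule order_trans[OF sum_abs]) (intro sum_mono sum_abs)
  also have "\<dots> \<le> (\<Sum>i\<in>?a. \<Sum>j=1..num_ext G. \<bar>k' i j - k i j\<bar>)"
    using sub by (intro sum_mono sum_mono2) auto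
  also have "\<dots> \<le> (\<Sum>i=1..num_ext G. \<Sum>j=1..num_ext G. \<bar>k' i j - k i j\<bar>)"
    using sub by (intro sum_mono2) (auto intro: sum_nonneg)
  finally show ?thesis .
qed

lemma symanzik_F_eq_F_poly:
  assumes "symanzik_system {1..num_int G} (spanning_trees (graph G)) (spanning_two_forests (graph G))
    (missing_labels G) (missing_labels G) d"
  shows "symanzik_F G (m, k) = symanzik_system.F_poly {1..num_int G} (spanning_trees (graph G))
    (spanning_two_forests (graph G)) (missing_labels G) (missing_labels G) m (momentum_coeff G k)"
proof -
  interpret symanzik_system "{1..num_int G}" "spanning_trees (graph G)" "spanning_two_forests (graph G)"
    "missing_labels G" "missing_labels G" d by fact
  show ?thesis
    unfolding F_poly_def U_poly_def
    by (simp only: symanzik_F.simps symanzik_U_def complement_monomial_def missing_labels_def)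
qed

text \<open>
  An interior point stays in the cone when all masses are lowered by some \<open>t > 0\<close>, which is strict
  copositivity with \<open>\<delta> = t\<close>. Conversely, \<open>D\<close> is a continuous distance from \<open>(m, k)\<close>, chosen such that
  \<open>F\<close> drops by at most \<open>D\<cdot>s\<cdot>U\<close>.
\<close>

lemma interior_copositive_cone_iff:
  assumes sys: "symanzik_system {1..num_int G} (spanning_trees (graph G)) (spanning_two_forests (graph G))
      (missing_labels G) (missing_labels G) d"
    and mk: "(m, k) \<in> kinematic_space G"
  shows "(m, k) \<in> top_of_set (kinematic_space G) interior_of (copositive_cone G) \<longleftrightarrow>
    symanzik_system.strictly_copositive {1..num_int G} (spanning_trees (graph G))
      (spanning_two_forests (graph G)) (missing_labels G) (missing_labels G) m (momentum_coeff G k)"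
proof -
  let ?I = "{1..num_int G}" and ?K = "kinematic_space G" and ?C = "copositive_cone G"
  interpret symanzik_system ?I "spanning_trees (graph G)" "spanning_two_forests (graph G)"
    "missing_labels G" "missing_labels G" d by fact
  have cone: "(m', k') \<in> ?C \<longleftrightarrow> (m', k') \<in> ?K \<and>
      (\<forall>u. (\<forall>e\<in>?I. u e \<ge> 0) \<longrightarrow> F_val m' (momentum_coeff G k') u \<ge> 0)" for m' k'
    unfolding copositive_cone_def symanzik_F_eq_F_poly[OF sys] mem_Collect_eq eval_F_poly ..
  show ?thesis
  proof
    assume "(m, k) \<in> top_of_set ?K interior_of ?C"
    then obtain W where W: "open W" "(m, k) \<in> W" "?K \<inter> W \<subseteq> ?C"
      unfolding interior_of_def openin_open by blast
    define f where "f t = ((\<lambda>e. m e - (if e \<in> ?I then 1 else 0) * t), k)" for t :: real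
    have "continuous_on UNIV f"
      unfolding f_def
      by (intro continuous_on_Pair continuous_on_const continuous_on_coordinatewise_then_product
          continuous_intros)
    then have "open (f -` W)"
      using W(1) by (simp add: open_vimage)
    moreover have "f 0 = (m, k)" by (auto simp: f_def)
    ultimately obtain \<epsilon> where \<epsilon>: "\<epsilon> > 0" "ball 0 \<epsilon> \<subseteq> f -` W"
      using W(2) by (metis open_contains_ball vimage_eq)
    define t where "t = \<epsilon> / 2"
    have "t > 0" "t \<in> ball 0 \<epsilon>" using \<epsilon>(1) by (auto simp: t_def dist_real_def)
    then have t: "t > 0" "f t \<in> W"
      using subsetD[OF \<epsilon>(2)] by (blast dest: vimageD)+
    have "f t \<in> ?K"
      using mk by (auto simp: f_def kinematic_space_def)
    then have "f t \<in> ?C" using W(3) t(2) by blast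
    then have pos: "F_val (fst (f t)) (momentum_coeff G k) u \<ge> 0" if "\<forall>e\<in>?I. u e \<ge> 0" for u
      using that cone[of "fst (f t)" k] by (simp add: f_def)
    have "F_val (fst (f t)) (momentum_coeff G k) u =
        F_val m (momentum_coeff G k) u - t * (\<Sum>e\<in>?I. u e) * U_val u" for u
    proof -
      have "(\<Sum>e\<in>?I. fst (f t) e * u e) = (\<Sum>e\<in>?I. m e * u e - t * u e)"
        by (intro sum.cong) (auto simp: f_def algebra_simps)
      also have "\<dots> = (\<Sum>e\<in>?I. m e * u e) - t * (\<Sum>e\<in>?I. u e)"
        by (simp add: sum_subtractf sum_distrib_left)
      finally have lin: "(\<Sum>e\<in>?I. fst (f t) e * u e) = (\<Sum>e\<in>?I. m e * u e) - t * (\<Sum>e\<in>?I. u e)" .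
      show ?thesis
        unfolding F_val_def lin by (simp only: left_diff_distrib add_diff_eq)
    qed
    then have "t * (\<Sum>e\<in>?I. u e) * U_val u \<le> F_val m (momentum_coeff G k) u" if "\<forall>e\<in>?I. u e \<ge> 0" for u
      using pos[OF that] by simp
    then show "strictly_copositive m (momentum_coeff G k)"
      unfolding strictly_copositive_def using t(1) by blast
  next
    assume "strictly_copositive m (momentum_coeff G k)"
    then obtain \<delta> where \<delta>: "\<delta> > 0"
      "\<And>u. (\<forall>e\<in>?I. u e \<ge> 0) \<Longrightarrow> \<delta> * (\<Sum>e\<in>?I. u e) * U_val u \<le> F_val m (momentum_coeff G k) u"
      unfolding strictly_copositive_def by blast
    define D where "D z = real (card (spanning_two_forests (graph G))) *
        (\<Sum>i=1..num_ext G. \<Sum>j=1..num_ext G. \<bar>snd z i j - k i j\<bar>) + (\<Sum>e\<in>?I. \<bar>fst z e - m e\<bar>)"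
      for z :: kinematics
    have m_cont: "continuous_on UNIV (\<lambda>z::kinematics. fst z e)" for e
      by (rule continuous_on_product_then_coordinatewise[OF continuous_on_fst[OF continuous_on_id]])
    have k_cont: "continuous_on UNIV (\<lambda>z::kinematics. snd z i j)" for i j
      by (rule continuous_on_product_then_coordinatewise[OF
            continuous_on_product_then_coordinatewise[OF continuous_on_snd[OF continuous_on_id]]])
    have "continuous_on UNIV D"
      unfolding D_def
      by (intro continuous_on_add continuous_on_mult continuous_on_sum continuous_on_rabs
          continuous_on_diff continuous_on_const m_cont k_cont)
    then have "open {z. D z < \<delta>}"
      by (rule open_Collect_less) (rule continuous_on_const)
    moreover have "D (m, k) < \<delta>" using \<delta>(1) by (simp add: D_def)
    moreover have "?K \<inter> {z. D z < \<delta>} \<subseteq> ?C"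
    proof
      fix z assume z: "z \<in> ?K \<inter> {z. D z < \<delta>}"
      obtain m' k' where z_eq: "z = (m', k')" by (cases z)
      have "F_val m' (momentum_coeff G k') u \<ge> 0" if u: "\<forall>e\<in>?I. u e \<ge> 0" for u
      proof -
        have nonneg: "(\<Sum>e\<in>?I. u e) * U_val u \<ge> 0"
          using u by (intro mult_nonneg_nonneg sum_nonneg U_val_nonneg) auto
        have "0 \<le> (\<delta> - D z) * ((\<Sum>e\<in>?I. u e) * U_val u)"
          using z by (intro mult_nonneg_nonneg[OF _ nonneg]) auto
        also have "\<dots> \<le> F_val m (momentum_coeff G k) u - D z * (\<Sum>e\<in>?I. u e) * U_val u"
          using \<delta>(2)[OF u] by (simp add: algebra_simps)
        also have "\<dots> \<le> F_val m' (momentum_coeff G k') u"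
          unfolding D_def z_eq fst_conv snd_conv
          using u by (intro F_val_perturb momentum_coeff_diff_le) auto
        finally show ?thesis .
      qed
      then show "z \<in> ?C" using z unfolding z_eq cone by blast
    qed
    ultimately show "(m, k) \<in> top_of_set ?K interior_of ?C"
      unfolding interior_of_def openin_open using mk by blast
  qed
qed

theorem theorem6p1:
  fixes G :: "('v, 'e) feynman" and m :: "nat \<Rightarrow> real" and k :: "nat \<Rightarrow> nat \<Rightarrow> real"
  assumes "feynman_graph G" and "bridgeless G" and "(m, k) \<in> kinematic_space G"
  shows "(m, k) \<in> top_of_set (kinematic_space G) interior_of (copositive_cone G) \<longleftrightarrow>
    (\<forall>e\<in>{1..num_int G}. m e > 0) \<and>
    (\<exists>r::nat. only_positive_coeffs ((\<Sum>e=1..num_int G. Var e) ^ r * symanzik_F G (m, k)))"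
proof -
  obtain d where sys: "symanzik_system {1..num_int G} (spanning_trees (graph G))
      (spanning_two_forests (graph G)) (missing_labels G) (missing_labels G) d"
    using feynman_symanzik_system[OF assms(1,2)] by blast
  show ?thesis
    unfolding interior_copositive_cone_iff[OF sys assms(3)] symanzik_F_eq_F_poly[OF sys]
    by (rule symanzik_system.strictly_copositive_iff_Polya[OF sys])
qed

end
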